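(* Let $n\ge2$ and let \[ \mathcal T_n=\{(\xi_1,\xi_2)\in\mathbb R^2:\hat\omega(\xi_1,\xi_2)>3n-4\}\times\{(\xi_3,\dots,\xi_n)\in\mathbb R^{n-2}:\omega(\xi_3,\dots,\xi_n)=n-2\}\subseteq\mathbb R^n. \] For every $\underline{x}\in\mathcal T_n$, some tail of the sequence of best approximations of $\underline{x}$ lies in the three-dimensional sublattice $\langle\mathbf e_1,\mathbf e_2,\mathbf e_{n+1}\rangle_{\mathbb Z}$ of $\mathbb Z^{n+1}$. In particular $\mathcal T_n\subseteq\Gamma_n$. Moreover $\hat\omega(\underline{x})=\hat\omega(\xi_1,\xi_2)$ and $\omega(\underline{x})=\omega(\xi_1,\xi_2)$ for every $\underline{x}=(\xi_1,\dots,\xi_n)\in\mathcal T_n$.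
   Context: Use the maximum norm; $\mathbf e_1,\dots,\mathbf e_{n+1}$ is the standard basis. For $\underline{x}=(\xi_1,\dots,\xi_m)\in\mathbb R^m$ write $\underline{x}^*=(\xi_1,\dots,\xi_m,1)$ and for $\mathbf y\in\mathbb R^{m+1}$ let $\hat{\mathbf y}$ be its first $m$ coordinates. $\underline{x}$ is totally irrational if $\mathbf q\cdot\underline{x}^*\ne0$ for all nonzero $\mathbf q\in\mathbb Z^{m+1}$. $\mathbf q\in\mathbb Z^{m+1}$ is a best approximation if $|\mathbf q\cdot\underline{x}^*|=\min\{|\mathbf b\cdot\underline{x}^*|:\mathbf b\in\mathbb Z^{m+1},0<\Vert\hat{\mathbf b}\Vert\le\Vert\hat{\mathbf q}\Vert\}$; ordered by increasing norm they form the sequence of best approximations. Exponents: $\hat\omega(\underline{x})=\sup\{t>0:\limsup_{Q\to\infty}Q^t\min_{\mathbf b\in\mathbb Z^{m+1},0<\Vert\hat{\mathbf b}\Vert\le Q}|\mathbf b\cdot\underline{x}^*|<\infty\}$, and $\omega(\underline{x})$ is defined identically with $\liminf$ in place of $\limsup$. $R(\underline{x})$ is the minimal $R$ such that some tail of best approximations lies in an $R$-dimensional sublattice of $\mathbb Z^{m+1}$; $\Gamma_n$ is the set of totally irrational $\underline{x}\in\mathbb R^n$ with $R(\underline{x})=3$. (Vectors in $\mathcal T_n$ are understood to be totally irrational.) *)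

theory Defs
  imports
    Complex_Main
    "HOL-Library.Extended_Nonnegative_Real"
    "Jordan_Normal_Form.Matrix"
    "Jordan_Normal_Form.VS_Connect"
begin

text \<open>Points of \<open>\<real>\<^sup>m\<close> and of \<open>\<int>\<^sup>m\<^sup>+\<^sup>1\<close> are vectors with a carrier, so
  that dimensions are terms. Coordinates are numbered from 0: the vector \<open>e\<^sub>i\<close> of the
  standard basis of \<open>\<int>\<^sup>d\<close> is \<open>unit_vec d (i - 1)\<close>.\<close>

text \<open>The inserted 0 only matters for the vector of dimension 0.\<close>

definition max_norm :: "'a :: linordered_idom vec \<Rightarrow> 'a" where
  "max_norm v = Max (insert 0 ((\<lambda>i. \<bar>v $ i\<bar>) ` {..<dim_vec v}))"

definition star :: "real vec \<Rightarrow> real vec" where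
  "star x = x @\<^sub>v vec 1 (\<lambda>_. 1)"

definition hat :: "'a vec \<Rightarrow> 'a vec" where
  "hat y = vec_first y (dim_vec y - 1)"

definition lin_form :: "real vec \<Rightarrow> int vec \<Rightarrow> real" where
  "lin_form x q = map_vec real_of_int q \<bullet> star x"

definition totally_irrational :: "real vec \<Rightarrow> bool" where
  "totally_irrational x \<longleftrightarrow>
     (\<forall>q \<in> carrier_vec (dim_vec x + 1). q \<noteq> 0\<^sub>v (dim_vec x + 1) \<longrightarrow> lin_form x q \<noteq> 0)"

definition best_approximation :: "real vec \<Rightarrow> int vec \<Rightarrow> bool" where
  "best_approximation x q \<longleftrightarrow>
     q \<in> carrier_vec (dim_vec x + 1) \<and> 0 < max_norm (hat q) \<and>
     (\<forall>b \<in> carrier_vec (dim_vec x + 1).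
        0 < max_norm (hat b) \<and> max_norm (hat b) \<le> max_norm (hat q) \<longrightarrow>
        \<bar>lin_form x q\<bar> \<le> \<bar>lin_form x b\<bar>)"

text \<open>For totally irrational \<open>x\<close>, two best approximations with equal norm differ at most by
  sign, so the sequence is unique up to the signs of its members; membership of a member in a
  sublattice does not depend on its sign.\<close>

definition best_approximation_sequence :: "real vec \<Rightarrow> (nat \<Rightarrow> int vec) \<Rightarrow> bool" where
  "best_approximation_sequence x q \<longleftrightarrow>
     (\<forall>k. best_approximation x (q k)) \<and>
     strict_mono (\<lambda>k. max_norm (hat (q k))) \<and>
     (\<forall>b. best_approximation x b \<longrightarrow> (\<exists>k. b = q k \<or> b = - q k))"

definition tail_in :: "real vec \<Rightarrow> int vec set \<Rightarrow> bool" where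
  "tail_in x L \<longleftrightarrow> (\<exists>q. best_approximation_sequence x q \<and> (\<exists>k0. \<forall>k \<ge> k0. q k \<in> L))"

definition int_span :: "nat \<Rightarrow> int vec set \<Rightarrow> int vec set" where
  "int_span d = LinearCombinations.module.span class_ring (module_vec TYPE(int) d)"

definition int_lin_indpt :: "nat \<Rightarrow> int vec set \<Rightarrow> bool" where
  "int_lin_indpt d B \<longleftrightarrow>
     \<not> LinearCombinations.module.lin_dep class_ring (module_vec TYPE(int) d) B"

definition sublattice :: "nat \<Rightarrow> nat \<Rightarrow> int vec set \<Rightarrow> bool" where
  "sublattice d R L \<longleftrightarrow>
     (\<exists>B \<subseteq> carrier_vec d. finite B \<and> card B = R \<and> int_lin_indpt d B \<and> L = int_span d B)"

definition approximation_rank :: "real vec \<Rightarrow> nat" where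
  "approximation_rank x = (LEAST R. \<exists>L. sublattice (dim_vec x + 1) R L \<and> tail_in x L)"

definition Gamma_set :: "nat \<Rightarrow> real vec set" where
  "Gamma_set n = {x \<in> carrier_vec n. totally_irrational x \<and> approximation_rank x = 3}"

text \<open>If \<open>x\<close> has positive dimension and \<open>Q \<ge> 1\<close>, this infimum is a minimum. In dimension 0
  there is no admissible \<open>b\<close> and its value is \<open>\<infinity>\<close>.\<close>

definition min_form :: "real vec \<Rightarrow> real \<Rightarrow> ennreal" where
  "min_form x Q =
     (INF b \<in> {b \<in> carrier_vec (dim_vec x + 1).
                0 < max_norm (hat b) \<and> real_of_int (max_norm (hat b)) \<le> Q}.
        ennreal \<bar>lin_form x b\<bar>)"

text \<open>Exponents take values in \<open>[0, \<infinity>]\<close>, where the supremum of the empty set is 0. In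
  particular both exponents of the vector of dimension 0 are 0.\<close>

definition omega_hat :: "real vec \<Rightarrow> ennreal" where
  "omega_hat x = Sup {ennreal t |t. 0 < t \<and>
     Limsup at_top (\<lambda>Q::real. ennreal (Q powr t) * min_form x Q) < \<infinity>}"

definition omega :: "real vec \<Rightarrow> ennreal" where
  "omega x = Sup {ennreal t |t. 0 < t \<and>
     Liminf at_top (\<lambda>Q::real. ennreal (Q powr t) * min_form x Q) < \<infinity>}"

definition T_set :: "nat \<Rightarrow> real vec set" where
  "T_set n = {y @\<^sub>v z |y z.
     y \<in> carrier_vec 2 \<and> omega_hat y > ennreal (3 * real n - 4) \<and>
     z \<in> carrier_vec (n - 2) \<and> omega z = ennreal (real n - 2) \<and>
     totally_irrational (y @\<^sub>v z)}"

end

theory Submission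
  imports Defs
begin

text \<open>Write \<open>x = (y, z)\<close> with \<open>y \<in> \<real>\<^sup>2\<close>, and \<open>L\<close> for the linear forms. Let \<open>q\<close> be a best approximation of
  \<open>x\<close> that involves a coordinate of \<open>z\<close>. Let \<open>p\<close> minimise \<open>\<bar>L(p)\<bar>\<close> for \<open>y\<close> among the integer
  vectors of norm at most \<open>\<parallel>q\<parallel>\<close>, and let \<open>p'\<close>, of norm \<open>X > \<parallel>q\<parallel>\<close>, be the shortest vector with a
  smaller value. Then \<open>\<bar>L(p)\<bar>\<close>, \<open>\<bar>L(p')\<bar>\<close> and \<open>\<bar>L(q)\<bar>\<close> are all \<open>O(X\<^sup>-\<^sup>t)\<close> for some \<open>t > 3n - 4\<close>.
  Eliminating \<open>y\<close> with the cross product \<open>w = p \<times> p'\<close> turns \<open>q\<close> into the integer form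
  \<open>(w\<^sub>3q\<^sub>3, \<dots>, w\<^sub>3q\<^sub>n, q\<^sub>1w\<^sub>1 + q\<^sub>2w\<^sub>2 + q\<^sub>n\<^sub>+\<^sub>1w\<^sub>3)\<close> in \<open>z\<close>, which has norm \<open>O(X\<^sup>3)\<close> and value
  \<open>O(X\<^sup>2\<^sup>-\<^sup>t)\<close>. For large \<open>X\<close> this contradicts \<open>\<omega>(z) = n - 2\<close>, since \<open>t - 2 > 3(n - 2)\<close>. Hence the
  long best approximations of \<open>x\<close> come from \<open>y\<close>, and the minimal values for \<open>x\<close> and \<open>y\<close> agree
  eventually.\<close>

section \<open>Heights and linear forms\<close>

abbreviation height :: "int vec \<Rightarrow> int" where
  "height q \<equiv> max_norm (hat q)"

lemma max_norm_le_iff: "0 \<le> c \<Longrightarrow> max_norm v \<le> c \<longleftrightarrow> (\<forall>i<dim_vec v. \<bar>v $ i\<bar> \<le> c)"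
  unfolding max_norm_def by auto

lemma hat_index: "q \<in> carrier_vec (Suc m) \<Longrightarrow> i < m \<Longrightarrow> hat q $ i = q $ i"
  unfolding hat_def vec_first_def by auto

lemma dim_hat: "dim_vec (hat q) = dim_vec q - 1"
  unfolding hat_def by auto

lemma height_le_iff:
  "q \<in> carrier_vec (Suc m) \<Longrightarrow> 0 \<le> c \<Longrightarrow> height q \<le> c \<longleftrightarrow> (\<forall>i<m. \<bar>q $ i\<bar> \<le> c)"
  using max_norm_le_iff[of c "hat q"] hat_index[of q m] by (auto simp: dim_hat)

lemma height_nonneg: "0 \<le> height q"
  unfolding max_norm_def by (simp add: Max_ge_iff)

lemma abs_index_le_height: "q \<in> carrier_vec (Suc m) \<Longrightarrow> i < m \<Longrightarrow> \<bar>q $ i\<bar> \<le> height q"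
  using height_le_iff[of q m "height q"] height_nonneg by auto

lemma height_pos_iff: "q \<in> carrier_vec (Suc m) \<Longrightarrow> 0 < height q \<longleftrightarrow> (\<exists>i<m. q $ i \<noteq> 0)"
  using height_le_iff[of q m 0] height_nonneg[of q] by force

text \<open>If every coordinate were at most \<open>height q - 1\<close>, so would be the maximum.
  Positivity excludes that the maximum is only the inserted 0.\<close>

lemma height_attained:
  assumes "q \<in> carrier_vec (Suc m)" "0 < height q"
  obtains i where "i < m" "\<bar>q $ i\<bar> = height q"
proof -
  have "\<not> height q \<le> height q - 1" by simp
  then obtain i where "i < m" "\<not> \<bar>q $ i\<bar> \<le> height q - 1"
    using height_le_iff[OF assms(1), of "height q - 1"] assms(2) by auto
  moreover have "\<bar>q $ i\<bar> \<le> height q"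
    using abs_index_le_height[OF assms(1) \<open>i < m\<close>] .
  ultimately show ?thesis using that[of i] by auto
qed

lemma nonzero_if_height_pos: "q \<in> carrier_vec (Suc m) \<Longrightarrow> 0 < height q \<Longrightarrow> q \<noteq> 0\<^sub>v (Suc m)"
  using height_pos_iff[of q m] by auto

lemma lin_form_eq:
  assumes "x \<in> carrier_vec m" "q \<in> carrier_vec (Suc m)"
  shows "lin_form x q = (\<Sum>i<m. real_of_int (q $ i) * x $ i) + real_of_int (q $ m)"
proof -
  have "lin_form x q = (\<Sum>i<Suc m. real_of_int (q $ i) * star x $ i)"
    using assms unfolding lin_form_def scalar_prod_def star_def
    by (intro sum.cong) (auto simp: lessThan_atLeast0)
  moreover have "star x $ m = 1" "\<And>i. i < m \<Longrightarrow> star x $ i = x $ i"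
    using assms unfolding star_def by auto
  ultimately show ?thesis by (auto intro!: sum.cong)
qed

lemma lin_form_minus:
  assumes "x \<in> carrier_vec m" "p \<in> carrier_vec (Suc m)" "q \<in> carrier_vec (Suc m)"
  shows "lin_form x (p - q) = lin_form x p - lin_form x q"
proof -
  have "p - q \<in> carrier_vec (Suc m)" using assms by auto
  then show ?thesis
    using assms by (simp add: lin_form_eq[of x m] sum_subtractf algebra_simps)
qed

lemma lin_form_plus:
  assumes "x \<in> carrier_vec m" "p \<in> carrier_vec (Suc m)" "q \<in> carrier_vec (Suc m)"
  shows "lin_form x (p + q) = lin_form x p + lin_form x q"
proof -
  have "p + q \<in> carrier_vec (Suc m)" using assms by auto
  then show ?thesis
    using assms by (simp add: lin_form_eq[of x m] sum.distrib algebra_simps)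
qed

section \<open>Finiteness and existence of minimisers\<close>

lemma finite_bounded_int_vecs:
  "finite {q \<in> carrier_vec d. \<forall>i<d. \<bar>q $ i\<bar> \<le> (B::int)}"
proof (rule finite_subset)
  show "{q \<in> carrier_vec d. \<forall>i<d. \<bar>q $ i\<bar> \<le> B} \<subseteq> vec d ` ({..<d} \<rightarrow>\<^sub>E {-B..B})"
  proof
    fix q :: "int vec" assume "q \<in> {q \<in> carrier_vec d. \<forall>i<d. \<bar>q $ i\<bar> \<le> B}"
    then have q: "q \<in> carrier_vec d" "\<And>i. i < d \<Longrightarrow> \<bar>q $ i\<bar> \<le> B" by auto
    have "q = vec d (restrict (($) q) {..<d})" using q by auto
    moreover have "restrict (($) q) {..<d} \<in> {..<d} \<rightarrow>\<^sub>E {-B..B}"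
      using q(2) by (auto simp: abs_le_iff minus_le_iff)
    ultimately show "q \<in> vec d ` ({..<d} \<rightarrow>\<^sub>E {-B..B})" by blast
  qed
  show "finite (vec d ` ({..<d} \<rightarrow>\<^sub>E {-B..B}))" by (intro finite_imageI finite_PiE) auto
qed

text \<open>The height leaves the last coordinate free; the bound on the form confines it to a
  bounded interval, so finitely many vectors remain.\<close>

lemma finite_bounded_lin_form:
  assumes x: "x \<in> carrier_vec m"
  shows "finite {q \<in> carrier_vec (Suc m). height q \<le> K \<and> \<bar>lin_form x q\<bar> \<le> c}"
proof (rule finite_subset)
  define S where "S = (\<Sum>i<m. \<bar>x $ i\<bar>)"
  \<comment> \<open>The ceiling bounds the last coordinate, which differs from the value of the form
    by at most \<open>\<bar>K\<bar> * S\<close>.\<close>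
  define B where "B = max K \<lceil>c + \<bar>real_of_int K\<bar> * S\<rceil>"
  show "finite {q \<in> carrier_vec (Suc m). \<forall>i<Suc m. \<bar>q $ i\<bar> \<le> B}"
    by (rule finite_bounded_int_vecs)
  show "{q \<in> carrier_vec (Suc m). height q \<le> K \<and> \<bar>lin_form x q\<bar> \<le> c}
      \<subseteq> {q \<in> carrier_vec (Suc m). \<forall>i<Suc m. \<bar>q $ i\<bar> \<le> B}"
  proof safe
    fix q :: "int vec" and i
    assume q: "q \<in> carrier_vec (Suc m)" "height q \<le> K" "\<bar>lin_form x q\<bar> \<le> c" and i: "i < Suc m"
    have K: "\<bar>q $ j\<bar> \<le> K" if "j < m" for j
      using abs_index_le_height[OF q(1) that] q(2) by linarith
    have "\<bar>\<Sum>i<m. real_of_int (q $ i) * x $ i\<bar> \<le> (\<Sum>i<m. \<bar>real_of_int K\<bar> * \<bar>x $ i\<bar>)"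
    proof (rule order_trans[OF sum_abs], rule sum_mono)
      fix j assume "j \<in> {..<m}"
      then have "\<bar>real_of_int (q $ j)\<bar> \<le> \<bar>real_of_int K\<bar>" using K[of j] by simp
      then show "\<bar>real_of_int (q $ j) * x $ j\<bar> \<le> \<bar>real_of_int K\<bar> * \<bar>x $ j\<bar>"
        by (simp add: abs_mult mult_right_mono)
    qed
    then have "\<bar>real_of_int (q $ m)\<bar> \<le> c + \<bar>real_of_int K\<bar> * S"
      using q(3) unfolding lin_form_eq[OF x q(1)] S_def sum_distrib_left by linarith
    then have "\<bar>q $ m\<bar> \<le> \<lceil>c + \<bar>real_of_int K\<bar> * S\<rceil>" by linarith
    then show "\<bar>q $ i\<bar> \<le> B"
      using K[of i] i unfolding B_def by (cases "i = m") auto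
  qed
qed

text \<open>A vector with a larger value than \<open>b\<close> cannot win, so the search runs over
  the finite set of those that do at least as well as \<open>b\<close>.\<close>

lemma exists_minimiser:
  assumes x: "x \<in> carrier_vec m"
    and b: "b \<in> carrier_vec (Suc m)" "0 < height b" "height b \<le> K"
  obtains p where "p \<in> carrier_vec (Suc m)" "0 < height p" "height p \<le> K"
    "\<And>c. c \<in> carrier_vec (Suc m) \<Longrightarrow> 0 < height c \<Longrightarrow> height c \<le> K \<Longrightarrow>
      \<bar>lin_form x p\<bar> \<le> \<bar>lin_form x c\<bar>"
proof -
  let ?S = "{q \<in> carrier_vec (Suc m). height q \<le> K \<and> \<bar>lin_form x q\<bar> \<le> \<bar>lin_form x b\<bar>}
    \<inter> {q. 0 < height q}"
  have fin: "finite ?S" using finite_bounded_lin_form[OF x] by blast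
  have ne: "?S \<noteq> {}" using b by blast
  obtain p where p: "p \<in> ?S" "\<And>c. c \<in> ?S \<Longrightarrow> \<bar>lin_form x p\<bar> \<le> \<bar>lin_form x c\<bar>"
    using ex_is_arg_min_if_finite[OF fin ne, of "\<lambda>q. \<bar>lin_form x q\<bar>"]
    unfolding is_arg_min_linorder by blast
  show ?thesis
  proof (rule that[of p])
    fix c assume c: "c \<in> carrier_vec (Suc m)" "0 < height c" "height c \<le> K"
    show "\<bar>lin_form x p\<bar> \<le> \<bar>lin_form x c\<bar>"
    proof (cases "\<bar>lin_form x c\<bar> \<le> \<bar>lin_form x b\<bar>")
      case True then show ?thesis using p(2) c by blast
    next
      case False then show ?thesis using p(1) by auto
    qed
  qed (use p(1) in auto)
qed

section \<open>Best approximations\<close>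

lemma totally_irrationalD:
  "totally_irrational x \<Longrightarrow> x \<in> carrier_vec m \<Longrightarrow> q \<in> carrier_vec (Suc m) \<Longrightarrow> lin_form x q = 0
    \<Longrightarrow> q = 0\<^sub>v (Suc m)"
  unfolding totally_irrational_def by force

lemma lin_form_nonzero:
  "totally_irrational x \<Longrightarrow> x \<in> carrier_vec m \<Longrightarrow> q \<in> carrier_vec (Suc m) \<Longrightarrow> 0 < height q
    \<Longrightarrow> lin_form x q \<noteq> 0"
  using totally_irrationalD nonzero_if_height_pos by blast

text \<open>By total irrationality the form vanishes at none of the finitely many short vectors with
  value at most 1; \<open>\<delta>\<close> is the least of their values and 1.\<close>

lemma height_large_if_lin_form_small:
  assumes x: "x \<in> carrier_vec m" "totally_irrational x"
  obtains \<delta> where "0 < \<delta>"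
    "\<And>b. b \<in> carrier_vec (Suc m) \<Longrightarrow> 0 < height b \<Longrightarrow> \<bar>lin_form x b\<bar> < \<delta> \<Longrightarrow> K < height b"
proof -
  let ?S = "{q \<in> carrier_vec (Suc m). height q \<le> K \<and> \<bar>lin_form x q\<bar> \<le> 1} \<inter> {q. 0 < height q}"
  let ?M = "insert 1 ((\<lambda>q. \<bar>lin_form x q\<bar>) ` ?S)"
  have fin: "finite ?M" using finite_bounded_lin_form[OF x(1)] by blast
  show ?thesis
  proof (rule that[of "Min ?M"])
    show "0 < Min ?M" using fin lin_form_nonzero[OF x(2,1)] by auto
    fix b assume b: "b \<in> carrier_vec (Suc m)" "0 < height b" "\<bar>lin_form x b\<bar> < Min ?M"
    then have *: "\<forall>s\<in>?M. \<bar>lin_form x b\<bar> < s" using fin by (subst (asm) Min_gr_iff) auto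
    show "K < height b"
    proof (rule ccontr)
      assume "\<not> K < height b"
      moreover have "\<bar>lin_form x b\<bar> \<le> 1" using * by auto
      ultimately have "b \<in> ?S" using b by auto
      then have "\<bar>lin_form x b\<bar> \<in> ?M" by blast
      with * show False by blast
    qed
  qed
qed

lemma best_approximation_iff:
  "x \<in> carrier_vec m \<Longrightarrow> best_approximation x q \<longleftrightarrow>
     q \<in> carrier_vec (Suc m) \<and> 0 < height q \<and>
     (\<forall>b \<in> carrier_vec (Suc m). 0 < height b \<and> height b \<le> height q \<longrightarrow>
        \<bar>lin_form x q\<bar> \<le> \<bar>lin_form x b\<bar>)"
  unfolding best_approximation_def by auto

lemma exists_best_approximation:
  assumes x: "x \<in> carrier_vec m"
    and b: "b \<in> carrier_vec (Suc m)" "0 < height b" "height b \<le> K"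
  obtains p where "best_approximation x p" "height p \<le> K"
    "\<And>c. c \<in> carrier_vec (Suc m) \<Longrightarrow> 0 < height c \<Longrightarrow> height c \<le> K \<Longrightarrow>
      \<bar>lin_form x p\<bar> \<le> \<bar>lin_form x c\<bar>"
proof -
  obtain p where p: "p \<in> carrier_vec (Suc m)" "0 < height p" "height p \<le> K"
    "\<And>c. c \<in> carrier_vec (Suc m) \<Longrightarrow> 0 < height c \<Longrightarrow> height c \<le> K \<Longrightarrow>
      \<bar>lin_form x p\<bar> \<le> \<bar>lin_form x c\<bar>"
    using exists_minimiser[OF assms] by blast
  moreover from this have "best_approximation x p"
    unfolding best_approximation_iff[OF x] by auto
  ultimately show ?thesis using that by blast
qed

text \<open>Equal heights make each vector a competitor of the other, so the values agree up to sign
  and the form vanishes at \<open>p - q\<close> or at \<open>p + q\<close>.\<close>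

lemma best_approximation_unique:
  assumes x: "x \<in> carrier_vec m" "totally_irrational x"
    and p: "best_approximation x p" and q: "best_approximation x q" and eq: "height p = height q"
  shows "p = q \<or> p = - q"
proof -
  note p' = p[unfolded best_approximation_iff[OF x(1)]] and q' = q[unfolded best_approximation_iff[OF x(1)]]
  have c: "p \<in> carrier_vec (Suc m)" "q \<in> carrier_vec (Suc m)" using p' q' by auto
  have "\<bar>lin_form x p\<bar> = \<bar>lin_form x q\<bar>" using p' q' eq by (intro antisym) auto
  then consider "lin_form x (p - q) = 0" | "lin_form x (p + q) = 0"
    unfolding lin_form_minus[OF x(1) c] lin_form_plus[OF x(1) c] by linarith
  then show ?thesis
  proof cases
    case 1
    then have z: "p - q = 0\<^sub>v (Suc m)" using totally_irrationalD[OF x(2,1)] c by auto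
    have "p = q"
    proof (rule eq_vecI)
      fix i assume "i < dim_vec q"
      then show "p $ i = q $ i" using arg_cong[OF z, of "\<lambda>v. v $ i"] c by auto
    qed (use c in auto)
    then show ?thesis ..
  next
    case 2
    then have z: "p + q = 0\<^sub>v (Suc m)" using totally_irrationalD[OF x(2,1)] c by auto
    have "p = - q"
    proof (rule eq_vecI)
      fix i assume "i < dim_vec (- q)"
      then show "p $ i = (- q) $ i" using arg_cong[OF z, of "\<lambda>v. v $ i"] c by auto
    qed (use c in auto)
    then show ?thesis ..
  qed
qed

text \<open>The height determines a best approximation up to sign, so the sequence enumerates the
  set \<open>S\<close> of occurring heights and picks one representative for each.\<close>

lemma exists_best_approximation_sequence:
  assumes x: "x \<in> carrier_vec m" "totally_irrational x"
    and small: "\<And>\<epsilon>. 0 < \<epsilon> \<Longrightarrow> \<exists>b \<in> carrier_vec (Suc m). 0 < height b \<and> \<bar>lin_form x b\<bar> < \<epsilon>"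
  obtains q where "best_approximation_sequence x q"
proof -
  define S where "S = {k. \<exists>b. best_approximation x b \<and> height b = int k}"
  have inf: "infinite S"
    unfolding infinite_nat_iff_unbounded
  proof
    fix K
    obtain \<delta> where \<delta>: "0 < \<delta>" "\<And>b. b \<in> carrier_vec (Suc m) \<Longrightarrow> 0 < height b
        \<Longrightarrow> \<bar>lin_form x b\<bar> < \<delta> \<Longrightarrow> int K < height b"
      using height_large_if_lin_form_small[OF x, where K = "int K"] by blast
    obtain b where b: "b \<in> carrier_vec (Suc m)" "0 < height b" "\<bar>lin_form x b\<bar> < \<delta>"
      using small[OF \<delta>(1)] by blast
    \<comment> \<open>A best approximation at least as good as \<open>b\<close> has a value below
      \<open>\<delta>\<close>, which forces its height beyond \<open>K\<close>.\<close>
    obtain p where p: "best_approximation x p" "\<bar>lin_form x p\<bar> \<le> \<bar>lin_form x b\<bar>"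
      using exists_best_approximation[OF x(1) b(1,2) order_refl] b(1,2) by blast
    then have "int K < height p"
      using \<delta>(2)[of p] b(3) unfolding best_approximation_iff[OF x(1)] by linarith
    then have "nat (height p) \<in> S" "K < nat (height p)" unfolding S_def using p(1) by auto
    then show "\<exists>k>K. k \<in> S" by blast
  qed
  define q where "q k = (SOME b. best_approximation x b \<and> height b = int (enumerate S k))" for k
  have q: "best_approximation x (q k) \<and> height (q k) = int (enumerate S k)" for k
  proof -
    have "enumerate S k \<in> S" using enumerate_in_set[OF inf] .
    then have "\<exists>b. best_approximation x b \<and> height b = int (enumerate S k)"
      unfolding S_def by (rule CollectD)
    then show ?thesis unfolding q_def by (rule someI_ex)
  qed
  have "best_approximation_sequence x q"
    unfolding best_approximation_sequence_def
  proof (intro conjI allI impI)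
    show "best_approximation x (q k)" for k using q by blast
    show "strict_mono (\<lambda>k. height (q k))"
      using strict_mono_enumerate[OF inf] q unfolding strict_mono_def by simp
    fix b assume b: "best_approximation x b"
    have hb: "height b = int (nat (height b))" using height_nonneg[of b] by simp
    have "nat (height b) \<in> S" unfolding S_def mem_Collect_eq using b hb by (intro exI conjI)
    then obtain k where k: "enumerate S k = nat (height b)"
      using enumerate_Ex[of S "nat (height b)"] inf by blast
    have "height b = height (q k)" using hb q[of k] k by simp
    then have "b = q k \<or> b = - q k" using best_approximation_unique[OF x b, of "q k"] q[of k] by simp
    then show "\<exists>k. b = q k \<or> b = - q k" ..
  qed
  then show ?thesis using that by blast
qed

section \<open>Exponents\<close>

text \<open>Some admissible exponent \<open>t\<close> already exceeds \<open>s\<close>. Its finite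
  limsup bounds the product for all large \<open>Q\<close>, and an infimum strictly below a bound
  yields an actual vector.\<close>

lemma omega_hat_gtD:
  assumes x: "x \<in> carrier_vec m" and s: "0 \<le> s" and gt: "ennreal s < omega_hat x"
  obtains t C Q0 where "s < t" "0 < C" "1 \<le> Q0"
    "\<And>Q. Q0 \<le> Q \<Longrightarrow> \<exists>b \<in> carrier_vec (Suc m).
      0 < height b \<and> real_of_int (height b) \<le> Q \<and> \<bar>lin_form x b\<bar> \<le> C * Q powr (- t)"
proof -
  obtain t where t: "ennreal s < ennreal t" "0 < t"
    "Limsup at_top (\<lambda>Q::real. ennreal (Q powr t) * min_form x Q) < \<infinity>"
    using gt unfolding omega_hat_def less_Sup_iff by blast
  have st: "s < t" using t(1) s by (simp add: ennreal_less_iff)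
  obtain c where c: "Limsup at_top (\<lambda>Q::real. ennreal (Q powr t) * min_form x Q) < c" "c < \<infinity>"
    using dense[OF t(3)] by blast
  obtain C where C: "c = ennreal C" "0 < C"
  proof -
    have "c \<noteq> 0" using c(1) by auto
    with c(2) that show ?thesis by (cases c) (auto simp: less_le)
  qed
  have "eventually (\<lambda>Q::real. ennreal (Q powr t) * min_form x Q < c) at_top"
    by (rule Limsup_lessD[OF c(1)])
  then obtain Q1 where Q1: "\<And>Q::real. Q1 \<le> Q \<Longrightarrow> ennreal (Q powr t) * min_form x Q < c"
    unfolding eventually_at_top_linorder by blast
  show ?thesis
  proof (rule that[of t C "max 1 Q1"])
    fix Q :: real assume Q: "max 1 Q1 \<le> Q"
    then have Qpos: "0 < Q powr t" by simp
    have eq: "ennreal (Q powr t) * ennreal (C * Q powr (- t)) = c"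
      using Qpos C Q by (simp add: ennreal_mult[symmetric] powr_minus field_simps)
    have "min_form x Q < ennreal (C * Q powr (- t))"
    proof (rule ccontr)
      assume "\<not> min_form x Q < ennreal (C * Q powr (- t))"
      then have "ennreal (Q powr t) * ennreal (C * Q powr (- t)) \<le> ennreal (Q powr t) * min_form x Q"
        by (intro mult_left_mono) auto
      with eq Q1[of Q] Q show False by (auto simp: not_le[symmetric])
    qed
    then obtain b where "b \<in> carrier_vec (dim_vec x + 1)" "0 < height b"
      "real_of_int (height b) \<le> Q" "ennreal \<bar>lin_form x b\<bar> < ennreal (C * Q powr (- t))"
      unfolding min_form_def INF_less_iff by blast
    then show "\<exists>b \<in> carrier_vec (Suc m). 0 < height b \<and> real_of_int (height b) \<le> Q
        \<and> \<bar>lin_form x b\<bar> \<le> C * Q powr (- t)"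
      using x by (intro bexI[of _ b]) (auto simp: ennreal_less_iff)
  qed (use st C in auto)
qed

text \<open>If the liminf were finite, \<open>s\<close> would be admissible and hence at most
  \<open>omega x\<close>. So it is infinite, and the product eventually exceeds every constant, here
  1.\<close>

lemma omega_lessD:
  assumes x: "x \<in> carrier_vec m" and s: "0 < s" and lt: "omega x < ennreal s"
  obtains Q0 where "\<And>Q b. Q0 \<le> Q \<Longrightarrow> b \<in> carrier_vec (Suc m) \<Longrightarrow> 0 < height b \<Longrightarrow>
      real_of_int (height b) \<le> Q \<Longrightarrow> 1 \<le> Q powr s * \<bar>lin_form x b\<bar>"
proof -
  let ?f = "\<lambda>Q::real. ennreal (Q powr s) * min_form x Q"
  have "\<not> Liminf at_top ?f < \<infinity>"
  proof
    assume "Liminf at_top ?f < \<infinity>"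
    then have "ennreal s \<le> omega x" unfolding omega_def using s by (intro Sup_upper) blast
    with lt show False by auto
  qed
  then have "Liminf at_top ?f = \<infinity>" by (metis infinity_ennreal_def top.not_eq_extremum)
  then have "1 < Liminf at_top ?f" by simp
  then have "eventually (\<lambda>Q. 1 < ?f Q) at_top" by (rule less_LiminfD)
  then obtain Q0 where Q0: "\<And>Q. Q0 \<le> Q \<Longrightarrow> 1 < ?f Q"
    unfolding eventually_at_top_linorder by blast
  show ?thesis
  proof (rule that[of Q0])
    fix Q b assume Q: "Q0 \<le> Q"
      and b: "b \<in> carrier_vec (Suc m)" "0 < height b" "real_of_int (height b) \<le> Q"
    have "min_form x Q \<le> ennreal \<bar>lin_form x b\<bar>"
      unfolding min_form_def using b x by (intro INF_lower) auto
    then have "?f Q \<le> ennreal (Q powr s) * ennreal \<bar>lin_form x b\<bar>"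
      by (intro mult_left_mono) auto
    then have "1 < ennreal (Q powr s * \<bar>lin_form x b\<bar>)"
      using Q0[OF Q] by (simp add: ennreal_mult)
    then show "1 \<le> Q powr s * \<bar>lin_form x b\<bar>"
      by simp
  qed
qed

lemma approximable_imp_small:
  assumes "(0::real) < t"
    and approx: "\<And>Q. Q0 \<le> Q \<Longrightarrow> \<exists>b \<in> carrier_vec (Suc m).
      0 < height b \<and> real_of_int (height b) \<le> Q \<and> \<bar>lin_form x b\<bar> \<le> C * Q powr (- t)"
    and "0 < \<epsilon>"
  shows "\<exists>b \<in> carrier_vec (Suc m). 0 < height b \<and> \<bar>lin_form x b\<bar> < \<epsilon>"
proof -
  have "((\<lambda>Q. C * Q powr (- t)) \<longlongrightarrow> C * 0) at_top"
    by (intro tendsto_mult tendsto_const tendsto_neg_powr filterlim_ident) (use assms in auto)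
  then have "eventually (\<lambda>Q. C * Q powr (- t) < \<epsilon>) at_top"
    using \<open>0 < \<epsilon>\<close> by (auto intro: order_tendstoD)
  then have "eventually (\<lambda>Q. C * Q powr (- t) < \<epsilon> \<and> Q0 \<le> Q) at_top"
    by (intro eventually_conj eventually_ge_at_top)
  then obtain Q where "C * Q powr (- t) < \<epsilon>" "Q0 \<le> Q"
    unfolding eventually_at_top_linorder by blast
  then show ?thesis using approx[of Q] by fastforce
qed

text \<open>Here \<open>p\<close> is optimal up to height \<open>K\<close> and \<open>p'\<close> is
  a shortest vector with a smaller value. Heights are integers, so no admissible vector of height at
  most \<open>height p' - 1\<close> improves on \<open>p\<close>; approximability at that bound
  controls the value of \<open>p\<close> by the height of the longer vector
  \<open>p'\<close>.\<close>

lemma exists_consecutive_minima: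
  assumes x: "x \<in> carrier_vec m" "totally_irrational x"
    and t: "0 < t" and C: "0 < C" and Q0: "1 \<le> Q0"
    and approx: "\<And>Q. Q0 \<le> Q \<Longrightarrow> \<exists>b \<in> carrier_vec (Suc m).
      0 < height b \<and> real_of_int (height b) \<le> Q \<and> \<bar>lin_form x b\<bar> \<le> C * Q powr (- t)"
    and K: "Q0 \<le> real_of_int K"
  obtains p p' where "p \<in> carrier_vec (Suc m)" "p' \<in> carrier_vec (Suc m)"
    "0 < height p" "height p \<le> K" "K < height p'" "\<bar>lin_form x p'\<bar> < \<bar>lin_form x p\<bar>"
    "\<bar>lin_form x p\<bar> \<le> C * 2 powr t * real_of_int (height p') powr (- t)"
proof -
  obtain b where "b \<in> carrier_vec (Suc m)" "0 < height b" "height b \<le> K"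
    using approx[OF K] by auto
  then obtain p where p: "p \<in> carrier_vec (Suc m)" "0 < height p" "height p \<le> K"
    "\<And>c. c \<in> carrier_vec (Suc m) \<Longrightarrow> 0 < height c \<Longrightarrow> height c \<le> K \<Longrightarrow>
      \<bar>lin_form x p\<bar> \<le> \<bar>lin_form x c\<bar>"
    using exists_minimiser[OF x(1)] by blast
  define P where "P b \<longleftrightarrow> b \<in> carrier_vec (Suc m) \<and> 0 < height b \<and> \<bar>lin_form x b\<bar> < \<bar>lin_form x p\<bar>" for b
  have "0 < \<bar>lin_form x p\<bar>" using lin_form_nonzero[OF x(2,1) p(1,2)] by simp
  then have "\<exists>b. P b" unfolding P_def
    using approximable_imp_small[OF t approx] by blast
  then obtain p' where p': "P p'" "\<And>b. P b \<Longrightarrow> nat (height p') \<le> nat (height b)"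
    using ex_has_least_nat[of P _ "\<lambda>b. nat (height b)"] by blast
  have big: "K < height p'"
    using p(4)[of p'] p'(1) unfolding P_def by linarith
  let ?X = "real_of_int (height p')"
  have XK: "real_of_int K \<le> ?X - 1" using big by linarith
  obtain b where b: "b \<in> carrier_vec (Suc m)" "0 < height b" "real_of_int (height b) \<le> ?X - 1"
    "\<bar>lin_form x b\<bar> \<le> C * (?X - 1) powr (- t)"
    using approx[of "?X - 1"] K XK by auto
  have "\<not> P b"
  proof
    assume "P b"
    then have "nat (height p') \<le> nat (height b)" by (rule p'(2))
    with b(2,3) show False by linarith
  qed
  then have "\<bar>lin_form x p\<bar> \<le> \<bar>lin_form x b\<bar>" unfolding P_def using b by auto
  also have "\<dots> \<le> C * (?X - 1) powr (- t)" by (rule b(4))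
  \<comment> \<open>Since \<open>K\<close> is at least 1, \<open>?X\<close> is at least 2, and
    \<open>?X - 1\<close> is at least \<open>?X / 2\<close>.\<close>
  also have "\<dots> \<le> C * (?X / 2) powr (- t)"
    using C t Q0 K XK by (intro mult_left_mono powr_mono2') auto
  also have "(?X / 2) powr (- t) = 2 powr t * ?X powr (- t)"
    using Q0 K XK by (simp add: powr_divide powr_minus field_simps)
  finally have "\<bar>lin_form x p\<bar> \<le> C * 2 powr t * ?X powr (- t)" by simp
  then show ?thesis using that[of p p'] p p'(1) big unfolding P_def by blast
qed

text \<open>This plays the role of the linear independence of \<open>p\<close> and \<open>p'\<close>.\<close>

lemma exists_nonzero_minor:
  assumes p: "p \<in> carrier_vec (Suc m)" "p' \<in> carrier_vec (Suc m)"
    and "height p < height p'" "\<bar>lin_form x p'\<bar> \<le> \<bar>lin_form x p\<bar>" "lin_form x p \<noteq> 0"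
  obtains i where "i < m" "real_of_int (p $ i) * lin_form x p' \<noteq> real_of_int (p' $ i) * lin_form x p"
proof -
  have "0 < height p'" using assms(3) height_nonneg[of p] by linarith
  \<comment> \<open>Where \<open>p'\<close> attains its height it strictly exceeds \<open>p\<close>,
    while its form is no larger; so the two products differ even in absolute value.\<close>
  then obtain i where i: "i < m" "\<bar>p' $ i\<bar> = height p'" using height_attained[OF p(2)] by blast
  have less: "\<bar>real_of_int (p $ i)\<bar> < \<bar>real_of_int (p' $ i)\<bar>"
    using abs_index_le_height[OF p(1) i(1)] i(2) assms(3) by linarith
  have "\<bar>real_of_int (p $ i)\<bar> * \<bar>lin_form x p'\<bar> \<le> \<bar>real_of_int (p $ i)\<bar> * \<bar>lin_form x p\<bar>"
    using assms(4) by (intro mult_left_mono) auto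
  also have "\<dots> < \<bar>real_of_int (p' $ i)\<bar> * \<bar>lin_form x p\<bar>"
    using less assms(5) by (intro mult_strict_right_mono) auto
  finally have "\<bar>real_of_int (p $ i) * lin_form x p'\<bar> \<noteq> \<bar>real_of_int (p' $ i) * lin_form x p\<bar>"
    by (simp add: abs_mult)
  then show ?thesis using that[OF i(1)] by metis
qed

section \<open>Long best approximations involve only the first two coordinates\<close>

lemma lin_form_append:
  assumes "y \<in> carrier_vec 2" "z \<in> carrier_vec m" "q \<in> carrier_vec (Suc (m + 2))"
  shows "lin_form (y @\<^sub>v z) q = real_of_int (q $ 0) * y $ 0 + real_of_int (q $ 1) * y $ 1
    + (\<Sum>i<m. real_of_int (q $ (i + 2)) * z $ i) + real_of_int (q $ (m + 2))"
proof -
  have yz: "y @\<^sub>v z \<in> carrier_vec (m + 2)"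
    using append_carrier_vec[OF assms(1,2)] by (simp add: add.commute)
  have split: "(\<Sum>i<m + 2. f i) = f 0 + f 1 + (\<Sum>i<m. f (i + 2))" for f :: "nat \<Rightarrow> real"
    by (simp add: sum.lessThan_Suc_shift del: sum.lessThan_Suc)
  show ?thesis
    unfolding lin_form_eq[OF yz assms(3)] split using assms by simp
qed

text \<open>Realises the integer forms in \<open>y\<close> as the sublattice of the theorem. Height
  and value are preserved, so vectors for \<open>y\<close> compete with vectors for the whole
  point.\<close>

definition planar_embedding :: "nat \<Rightarrow> int vec \<Rightarrow> int vec" where
  "planar_embedding m p = vec (Suc (m + 2)) (\<lambda>i. if i < 2 then p $ i else if i = m + 2 then p $ 2 else 0)"

lemma planar_embedding_carrier: "planar_embedding m p \<in> carrier_vec (Suc (m + 2))"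
  unfolding planar_embedding_def by simp

lemma lin_form_planar_embedding:
  assumes "y \<in> carrier_vec 2" "z \<in> carrier_vec m" "p \<in> carrier_vec 3"
  shows "lin_form (y @\<^sub>v z) (planar_embedding m p) = lin_form y p"
proof -
  have p: "p \<in> carrier_vec (Suc 2)" using assms by (simp add: numeral_3_eq_3 numeral_2_eq_2)
  show ?thesis
    unfolding lin_form_append[OF assms(1,2) planar_embedding_carrier] lin_form_eq[OF assms(1) p]
    unfolding planar_embedding_def by (simp add: numeral_2_eq_2)
qed

lemma height_planar_embedding:
  assumes p: "p \<in> carrier_vec 3"
  shows "height (planar_embedding m p) = height p"
proof -
  have p: "p \<in> carrier_vec (Suc 2)" using assms by (simp add: numeral_3_eq_3 numeral_2_eq_2)
  have "height (planar_embedding m p) \<le> c \<longleftrightarrow> height p \<le> c" if "0 \<le> c" for c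
  proof -
    have "height (planar_embedding m p) \<le> c \<longleftrightarrow> (\<forall>i<m + 2. \<bar>planar_embedding m p $ i\<bar> \<le> c)"
      by (rule height_le_iff[OF planar_embedding_carrier that])
    also have "\<dots> \<longleftrightarrow> (\<forall>i<2. \<bar>p $ i\<bar> \<le> c)"
      using that unfolding planar_embedding_def by (auto split: if_splits)
    also have "\<dots> \<longleftrightarrow> height p \<le> c" by (rule height_le_iff[OF p that, symmetric])
    finally show ?thesis .
  qed
  from this[of "height p"] this[of "height (planar_embedding m p)"]
  show ?thesis using height_nonneg by (intro antisym) auto
qed

text \<open>An integer relation for \<open>y\<close> would embed as one for the whole point.\<close>

lemma totally_irrational_first:
  assumes y: "y \<in> carrier_vec 2" and z: "z \<in> carrier_vec m" and irr: "totally_irrational (y @\<^sub>v z)"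
  shows "totally_irrational y"
  unfolding totally_irrational_def
proof (intro ballI impI notI)
  fix p assume p: "p \<in> carrier_vec (dim_vec y + 1)" "p \<noteq> 0\<^sub>v (dim_vec y + 1)" "lin_form y p = 0"
  have p3: "p \<in> carrier_vec 3" "p \<noteq> 0\<^sub>v 3" using p y by (auto simp: numeral_3_eq_3 numeral_2_eq_2)
  have "lin_form (y @\<^sub>v z) (planar_embedding m p) = 0"
    using lin_form_planar_embedding[OF y z p3(1)] p(3) by simp
  moreover have "y @\<^sub>v z \<in> carrier_vec (m + 2)"
    using append_carrier_vec[OF y z] by (simp add: add.commute)
  ultimately have e: "planar_embedding m p = 0\<^sub>v (Suc (m + 2))"
    using totally_irrationalD[OF irr _ planar_embedding_carrier] by blast
  have "p $ i = 0" if "i < 3" for i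
  proof -
    consider "i < 2" | "i = 2" using \<open>i < 3\<close> by linarith
    then show ?thesis
    proof cases
      case 1
      then show ?thesis using arg_cong[OF e, of "\<lambda>v. v $ i"] unfolding planar_embedding_def by auto
    next
      case 2
      then show ?thesis using arg_cong[OF e, of "\<lambda>v. v $ (m + 2)"] unfolding planar_embedding_def by auto
    qed
  qed
  then have "p = 0\<^sub>v 3" using p3(1) by (intro eq_vecI) auto
  with p3(2) show False ..
qed

text \<open>The witnesses are the coordinates of the cross product of the two coefficient vectors.
  If both forms vanished, it would be proportional to \<open>(\<xi>0, \<xi>1, 1)\<close>; small
  forms make it nearly so, which gives simultaneous approximations with common denominator
  \<open>w2\<close>.\<close>

lemma cross_product_estimate:
  fixes p0 p1 p2 r0 r1 r2 :: int and \<xi>0 \<xi>1 u v X \<eta> :: real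
  assumes u: "u = p0 * \<xi>0 + p1 * \<xi>1 + p2" "\<bar>u\<bar> \<le> \<eta>"
    and v: "v = r0 * \<xi>0 + r1 * \<xi>1 + r2" "\<bar>v\<bar> \<le> \<eta>"
    and p: "\<bar>real_of_int p0\<bar> \<le> X" "\<bar>real_of_int p1\<bar> \<le> X"
    and r: "\<bar>real_of_int r0\<bar> \<le> X" "\<bar>real_of_int r1\<bar> \<le> X"
    and small: "2 * X * \<eta> < 1"
    and indep: "p0 * v \<noteq> r0 * u \<or> p1 * v \<noteq> r1 * u"
  obtains w0 w1 w2 :: int where "w2 \<noteq> 0" "\<bar>real_of_int w2\<bar> \<le> 2 * X\<^sup>2"
    "\<bar>w2 * \<xi>0 - w0\<bar> \<le> 2 * X * \<eta>" "\<bar>w2 * \<xi>1 - w1\<bar> \<le> 2 * X * \<eta>"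
proof -
  define w0 w1 w2 where "w0 = p1 * r2 - p2 * r1" and "w1 = p2 * r0 - p0 * r2"
    and "w2 = p0 * r1 - p1 * r0"
  have e0: "w2 * \<xi>0 - w0 = r1 * u - p1 * v" and e1: "w2 * \<xi>1 - w1 = p0 * v - r0 * u"
    unfolding w0_def w1_def w2_def u v by (simp_all add: algebra_simps)
  have prod: "\<bar>a * c - b * d\<bar> \<le> 2 * X * \<eta>"
    if "\<bar>a\<bar> \<le> X" "\<bar>b\<bar> \<le> X" "\<bar>c\<bar> \<le> \<eta>" "\<bar>d\<bar> \<le> \<eta>" for a b c d :: real
  proof -
    have "\<bar>a * c\<bar> \<le> X * \<eta>" "\<bar>b * d\<bar> \<le> X * \<eta>" unfolding abs_mult using that by (auto intro!: mult_mono)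
    then show ?thesis by linarith
  qed
  have b0: "\<bar>w2 * \<xi>0 - w0\<bar> \<le> 2 * X * \<eta>" and b1: "\<bar>w2 * \<xi>1 - w1\<bar> \<le> 2 * X * \<eta>"
    unfolding e0 e1 using p r u(2) v(2) by (auto intro!: prod)
  have b2: "\<bar>real_of_int w2\<bar> \<le> 2 * X\<^sup>2"
  proof -
    have "\<bar>real_of_int p0 * r1\<bar> \<le> X * X" "\<bar>real_of_int p1 * r0\<bar> \<le> X * X"
      unfolding abs_mult using p r by (auto intro!: mult_mono)
    then show ?thesis unfolding w2_def by (simp add: power2_eq_square)
  qed
  \<comment> \<open>If \<open>w2\<close> vanished, \<open>w0\<close> and \<open>w1\<close> would be
    integers of absolute value below 1, hence 0, and \<open>e0\<close>, \<open>e1\<close> would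
    contradict \<open>indep\<close>.\<close>
  have "w2 \<noteq> 0"
  proof
    assume "w2 = 0"
    then have "w0 = 0" "w1 = 0" using b0 b1 small by auto
    with \<open>w2 = 0\<close> e0 e1 indep show False by simp
  qed
  then show ?thesis using that b0 b1 b2 by blast
qed

text \<open>With \<open>n = m + 2\<close> the threshold \<open>3 * m + 2\<close> is
  \<open>3n - 4\<close>. It is where the exponent \<open>(t - 2) / 3\<close>, the result of a height
  of order \<open>X ^ 3\<close> and a value of order \<open>X powr (2 - t)\<close>, passes
  \<open>m\<close>.\<close>

lemma best_approximation_eventually_planar:
  assumes y: "y \<in> carrier_vec 2" and z: "z \<in> carrier_vec m"
    and irr: "totally_irrational (y @\<^sub>v z)"
    and hat: "ennreal (3 * real m + 2) < omega_hat y" and om: "omega z = ennreal (real m)"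
  obtains K where "\<And>q i. best_approximation (y @\<^sub>v z) q \<Longrightarrow> K \<le> height q \<Longrightarrow> i < m
    \<Longrightarrow> q $ (i + 2) = 0"
proof -
  have yz: "y @\<^sub>v z \<in> carrier_vec (m + 2)"
    using append_carrier_vec[OF y z] by (simp add: add.commute)
  note irry = totally_irrational_first[OF y z irr]
  have nonneg: "0 \<le> 3 * real m + 2" by simp
  obtain t C Q0 where t: "3 * real m + 2 < t" and C: "0 < C" and Q0: "1 \<le> Q0" and approx:
    "\<And>Q. Q0 \<le> Q \<Longrightarrow> \<exists>b \<in> carrier_vec (Suc 2).
      0 < height b \<and> real_of_int (height b) \<le> Q \<and> \<bar>lin_form y b\<bar> \<le> C * Q powr (- t)"
    by (rule omega_hat_gtD[OF y nonneg hat]) blast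
  \<comment> \<open>The midpoint of \<open>m\<close> and \<open>(t - 2) / 3\<close>: above
    \<open>omega z\<close>, yet small enough for the final contradiction.\<close>
  define s where "s = real m + (t - (3 * real m + 2)) / 6"
  have s: "real m < s" "3 * s + 2 < t" using t by (simp_all add: s_def field_simps)
  then have "omega z < ennreal s" unfolding om by (simp add: ennreal_less_iff)
  then obtain Q1 where Q1: "\<And>Q b. Q1 \<le> Q \<Longrightarrow> b \<in> carrier_vec (Suc m) \<Longrightarrow> 0 < height b \<Longrightarrow>
      real_of_int (height b) \<le> Q \<Longrightarrow> 1 \<le> Q powr s * \<bar>lin_form z b\<bar>"
    using omega_lessD[OF z, of s] s by auto
  define A where "A = C * 2 powr t"
  have A: "0 < A" unfolding A_def using C by simp
  have lim: "((\<lambda>X::real. B * X powr (- e)) \<longlongrightarrow> B * 0) at_top" if "0 < e" for B e :: real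
    by (intro tendsto_mult tendsto_const tendsto_neg_powr filterlim_ident) (use that in simp)
  \<comment> \<open>The first inequality will keep \<open>w2\<close> nonzero, the second contradicts
    the final lower bound 1, and the third puts \<open>X\<close> beyond the thresholds for both
    exponents.\<close>
  have "eventually (\<lambda>X::real. 2 * A * X powr (- (t - 1)) < 1
      \<and> 6 * A * 2 powr s * X powr (- (t - (3 * s + 2))) < 1 \<and> max Q0 Q1 \<le> X) at_top"
    using lim[of "t - 1" "2 * A"] lim[of "t - (3 * s + 2)" "6 * A * 2 powr s"] s t
    by (intro eventually_conj eventually_ge_at_top) (auto intro: order_tendstoD)
  then obtain X0 where X0: "\<And>X. X0 \<le> X \<Longrightarrow> 2 * A * X powr (- (t - 1)) < 1
      \<and> 6 * A * 2 powr s * X powr (- (t - (3 * s + 2))) < 1 \<and> max Q0 Q1 \<le> X"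
    unfolding eventually_at_top_linorder by blast
  show ?thesis
  proof (rule that[of "\<lceil>X0\<rceil>"], rule ccontr)
    fix q j assume q: "best_approximation (y @\<^sub>v z) q" and big: "\<lceil>X0\<rceil> \<le> height q"
      and j: "j < m" "q $ (j + 2) \<noteq> 0"
    define Q where "Q = real_of_int (height q)"
    have "X0 \<le> Q" unfolding Q_def using big by linarith
    note Q = X0[OF this]
    have qc: "q \<in> carrier_vec (Suc (m + 2))" using q unfolding best_approximation_iff[OF yz] by blast
    have "Q0 \<le> real_of_int (height q)" using Q unfolding Q_def by simp
    then obtain p p' where p: "p \<in> carrier_vec (Suc 2)" "p' \<in> carrier_vec (Suc 2)"
      "0 < height p" "height p \<le> height q" "height q < height p'" "\<bar>lin_form y p'\<bar> < \<bar>lin_form y p\<bar>"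
      "\<bar>lin_form y p\<bar> \<le> A * real_of_int (height p') powr (- t)"
      using exists_consecutive_minima[OF y irry _ C Q0 approx, of "height q"] t
      unfolding A_def by auto
    define X where "X = real_of_int (height p')"
    define \<eta> where "\<eta> = A * X powr (- t)"
    have QX: "Q \<le> X" unfolding Q_def X_def using p(5) by simp
    have X0X: "X0 \<le> X" using QX \<open>X0 \<le> Q\<close> by simp
    have X1: "1 \<le> X" using X0[OF X0X] Q0 by auto
    have \<eta>: "\<bar>lin_form y p\<bar> \<le> \<eta>" "\<bar>lin_form y p'\<bar> \<le> \<eta>" "0 \<le> \<eta>"
      using p(6,7) A unfolding X_def \<eta>_def by auto
    have p3: "p \<in> carrier_vec 3" using p(1) by (simp add: numeral_3_eq_3 numeral_2_eq_2)
    \<comment> \<open>The embedding of \<open>p\<close> is no longer than \<open>q\<close>, so the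
      best approximation \<open>q\<close> does at least as well.\<close>
    have L\<eta>: "\<bar>lin_form (y @\<^sub>v z) q\<bar> \<le> \<eta>"
    proof -
      have "\<bar>lin_form (y @\<^sub>v z) q\<bar> \<le> \<bar>lin_form (y @\<^sub>v z) (planar_embedding m p)\<bar>"
        using q p(3,4) planar_embedding_carrier[of m p] height_planar_embedding[OF p3, of m]
        unfolding best_approximation_iff[OF yz] by auto
      then show ?thesis using \<eta>(1) lin_form_planar_embedding[OF y z p3] by simp
    qed
    have small: "2 * X * \<eta> < 1"
    proof -
      have "X powr (- (t - 1)) = X * X powr (- t)" using X1 powr_add[of X 1 "- t"] by simp
      then have "2 * X * \<eta> = 2 * A * X powr (- (t - 1))" unfolding \<eta>_def by simp
      then show ?thesis using X0[OF X0X] by simp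
    qed
    have index: "\<bar>real_of_int (p $ i)\<bar> \<le> X" "\<bar>real_of_int (p' $ i)\<bar> \<le> X" if "i < 2" for i
      using abs_index_le_height[OF p(1) that] abs_index_le_height[OF p(2) that] p(4,5)
      unfolding X_def by linarith+
    have Ly: "lin_form y r = real_of_int (r $ 0) * y $ 0 + real_of_int (r $ 1) * y $ 1 + real_of_int (r $ 2)"
      if "r \<in> carrier_vec (Suc 2)" for r
      unfolding lin_form_eq[OF y that] by (simp add: numeral_2_eq_2)
    obtain k where k: "k < 2"
      "real_of_int (p $ k) * lin_form y p' \<noteq> real_of_int (p' $ k) * lin_form y p"
    proof (rule exists_nonzero_minor[OF p(1,2)])
      show "height p < height p'" using p(4,5) by linarith
      show "\<bar>lin_form y p'\<bar> \<le> \<bar>lin_form y p\<bar>" using p(6) by linarith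
      show "lin_form y p \<noteq> 0" by (rule lin_form_nonzero[OF irry y p(1,3)])
    qed
    have indep: "real_of_int (p $ 0) * lin_form y p' \<noteq> real_of_int (p' $ 0) * lin_form y p
        \<or> real_of_int (p $ 1) * lin_form y p' \<noteq> real_of_int (p' $ 1) * lin_form y p"
    proof -
      have "k = 0 \<or> k = 1" using k(1) by auto
      then show ?thesis using k(2) by auto
    qed
    have lt2: "(0::nat) < 2" "(1::nat) < 2" by simp_all
    obtain w0 w1 w2 :: int where w: "w2 \<noteq> 0" "\<bar>real_of_int w2\<bar> \<le> 2 * X\<^sup>2"
      "\<bar>w2 * y $ 0 - w0\<bar> \<le> 2 * X * \<eta>" "\<bar>w2 * y $ 1 - w1\<bar> \<le> 2 * X * \<eta>"
      by (rule cross_product_estimate[OF Ly[OF p(1)] \<eta>(1) Ly[OF p(2)] \<eta>(2) index(1)[OF lt2(1)]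
          index(1)[OF lt2(2)] index(2)[OF lt2(1)] index(2)[OF lt2(2)] small indep])
    \<comment> \<open>Multiplying the form of \<open>q\<close> by \<open>w2\<close> and replacing
      \<open>w2 * y $ 0\<close> and \<open>w2 * y $ 1\<close> by the integers \<open>w0\<close> and
      \<open>w1\<close> leaves an integer form in \<open>z\<close> alone. Its coordinate
      \<open>j\<close> is nonzero.\<close>
    define b where "b = vec (Suc m) (\<lambda>i. if i < m then w2 * q $ (i + 2)
      else q $ 0 * w0 + q $ 1 * w1 + q $ (m + 2) * w2)"
    have bc: "b \<in> carrier_vec (Suc m)" unfolding b_def by simp
    have qQ: "\<bar>real_of_int (q $ i)\<bar> \<le> Q" if "i < m + 2" for i
      using abs_index_le_height[OF qc that] unfolding Q_def by linarith
    have bpos: "0 < height b"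
      unfolding height_pos_iff[OF bc] using j w(1) by (intro exI[of _ j]) (simp add: b_def)
    have bX: "real_of_int (height b) \<le> 2 * X ^ 3"
    proof -
      obtain i where i: "i < m" "\<bar>b $ i\<bar> = height b" using height_attained[OF bc bpos] .
      have "real_of_int (height b) = \<bar>real_of_int w2\<bar> * \<bar>real_of_int (q $ (i + 2))\<bar>"
      proof -
        have "b $ i = w2 * q $ (i + 2)" using i(1) unfolding b_def by simp
        then show ?thesis unfolding i(2)[symmetric] by (simp add: abs_mult)
      qed
      also have "\<dots> \<le> (2 * X\<^sup>2) * X"
        using qQ[of "i + 2"] i(1) QX w(2) by (intro mult_mono) auto
      finally show ?thesis by (simp add: power3_eq_cube power2_eq_square)
    qed
    \<comment> \<open>The value of \<open>q\<close> times \<open>w2\<close> and two replacement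
      errors remain. Each is at most \<open>2 * X\<^sup>2 * \<eta>\<close>, whence the constant 6
      below.\<close>
    have "lin_form z b = w2 * lin_form (y @\<^sub>v z) q
        - q $ 0 * (w2 * y $ 0 - w0) - q $ 1 * (w2 * y $ 1 - w1)"
    proof -
      have "(\<Sum>i<m. real_of_int (b $ i) * z $ i) = w2 * (\<Sum>i<m. real_of_int (q $ (i + 2)) * z $ i)"
        unfolding sum_distrib_left by (intro sum.cong) (auto simp: b_def)
      moreover have "b $ m = q $ 0 * w0 + q $ 1 * w1 + q $ (m + 2) * w2"
        unfolding b_def by simp
      moreover have "W * S + (a * \<alpha> + c * \<gamma> + e * W)
          = W * (a * u + c * v + S + e) - a * (W * u - \<alpha>) - c * (W * v - \<gamma>)"
        for W S a \<alpha> c \<gamma> e u v :: real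
        by (simp add: algebra_simps)
      ultimately show ?thesis
        unfolding lin_form_append[OF y z qc] lin_form_eq[OF z bc] by (simp only: of_int_add of_int_mult)
    qed
    moreover have "\<bar>w2 * lin_form (y @\<^sub>v z) q\<bar> \<le> 2 * X\<^sup>2 * \<eta>"
      unfolding abs_mult using w(2) L\<eta> by (intro mult_mono) auto
    moreover have "\<bar>q $ 0 * (w2 * y $ 0 - w0)\<bar> \<le> X * (2 * X * \<eta>)"
      unfolding abs_mult using w(3) qQ[of 0] QX X1 by (intro mult_mono) auto
    moreover have "\<bar>q $ 1 * (w2 * y $ 1 - w1)\<bar> \<le> X * (2 * X * \<eta>)"
      unfolding abs_mult using w(4) qQ[of 1] QX X1 by (intro mult_mono) auto
    moreover have "X * (2 * X * \<eta>) = 2 * X\<^sup>2 * \<eta>" by (simp add: power2_eq_square)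
    ultimately have Lb: "\<bar>lin_form z b\<bar> \<le> 6 * X\<^sup>2 * \<eta>" by linarith
    have "Q1 \<le> 2 * X ^ 3"
    proof -
      have "X \<le> X ^ 3" using X1 by (simp add: self_le_power)
      then show ?thesis using X0[OF X0X] X1 by linarith
    qed
    then have "1 \<le> (2 * X ^ 3) powr s * \<bar>lin_form z b\<bar>" by (rule Q1[OF _ bc bpos bX])
    also have "\<dots> \<le> (2 * X ^ 3) powr s * (6 * X\<^sup>2 * \<eta>)" using Lb by (intro mult_left_mono) auto
    also have "(2 * X ^ 3) powr s = 2 powr s * X powr (3 * s)"
    proof -
      have "(X ^ 3) powr s = (X powr 3) powr s" using X1 by simp
      also have "\<dots> = X powr (3 * s)" by (rule powr_powr)
      finally show ?thesis using X1 by (simp add: powr_mult)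
    qed
    also have "2 powr s * X powr (3 * s) * (6 * X\<^sup>2 * \<eta>)
        = 6 * A * 2 powr s * (X powr (3 * s) * X powr 2 * X powr (- t))"
      unfolding \<eta>_def using X1 by simp
    also have "\<dots> = 6 * A * 2 powr s * X powr (- (t - (3 * s + 2)))"
    proof -
      have "X powr (3 * s) * X powr 2 * X powr (- t) = X powr (3 * s + 2 + - t)"
        by (simp only: powr_add)
      also have "3 * s + 2 + - t = - (t - (3 * s + 2))" by simp
      finally show ?thesis by simp
    qed
    finally show False using X0[OF X0X] by simp
  qed
qed

section \<open>Sublattices of integer vectors\<close>

text \<open>Replaces the module-theoretic span by coordinate equations, so that the lattice
  arguments can be carried out with integer sums.\<close>

lemma in_int_span_iff:
  assumes B: "finite B" "B \<subseteq> carrier_vec d"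
  shows "q \<in> int_span d B \<longleftrightarrow>
    q \<in> carrier_vec d \<and> (\<exists>a. \<forall>i<d. q $ i = (\<Sum>v\<in>B. a v * v $ i))"
proof -
  interpret V: vec_module "TYPE(int)" d .
  have index: "V.lincomb a B $ i = (\<Sum>v\<in>B. a v * v $ i)" if "i < d" for a i
    unfolding V.lincomb_def using B that
    by (subst V.finsum_index) (auto intro!: sum.cong)
  have closed: "V.lincomb a B \<in> carrier_vec d" for a
    using V.lincomb_closed[OF B(2)] by simp
  have span: "int_span d B = range (\<lambda>a. V.lincomb a B)"
    unfolding int_span_def using V.finite_span[OF B] by auto
  show ?thesis
  proof
    assume "q \<in> int_span d B"
    then show "q \<in> carrier_vec d \<and> (\<exists>a. \<forall>i<d. q $ i = (\<Sum>v\<in>B. a v * v $ i))"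
      unfolding span using index closed by auto
  next
    assume q: "q \<in> carrier_vec d \<and> (\<exists>a. \<forall>i<d. q $ i = (\<Sum>v\<in>B. a v * v $ i))"
    then obtain a where a: "\<And>i. i < d \<Longrightarrow> q $ i = (\<Sum>v\<in>B. a v * v $ i)" by blast
    have "q = V.lincomb a B"
    proof (rule eq_vecI)
      show "dim_vec q = dim_vec (V.lincomb a B)" using q closed[of a] by simp
      show "q $ i = V.lincomb a B $ i" if "i < dim_vec (V.lincomb a B)" for i
        using that closed[of a] index[of i a] a[of i] by simp
    qed
    then show "q \<in> int_span d B" unfolding span by blast
  qed
qed

lemma int_lin_indptI:
  assumes B: "finite B" "B \<subseteq> carrier_vec d"
    and indpt: "\<And>a v. (\<forall>i<d. (\<Sum>v\<in>B. a v * v $ i) = 0) \<Longrightarrow> v \<in> B \<Longrightarrow> a v = 0"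
  shows "int_lin_indpt d B"
proof -
  interpret V: vec_module "TYPE(int)" d .
  have index: "V.lincomb a B $ i = (\<Sum>v\<in>B. a v * v $ i)" if "i < d" for a i
    unfolding V.lincomb_def using B that
    by (subst V.finsum_index) (auto intro!: sum.cong)
  show ?thesis
    unfolding int_lin_indpt_def
  proof (rule V.finite_lin_indpt2[OF B])
    fix a assume lc: "V.lincomb a B = 0\<^sub>v d"
    have "(\<Sum>v\<in>B. a v * v $ i) = 0" if "i < d" for i
      using index[OF that, of a] that unfolding lc by simp
    then show "\<forall>v\<in>B. a v = 0" using indpt by blast
  qed
qed

section \<open>Sublattices spanned by unit vectors or by few generators\<close>

lemma inj_on_unit_vec: "I \<subseteq> {..<d} \<Longrightarrow> inj_on (unit_vec d :: nat \<Rightarrow> int vec) I"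
  by (rule inj_onI) (metis index_unit_vec(1) lessThan_iff subsetD zero_neq_one)

lemma sum_unit_vecs:
  fixes a :: "int vec \<Rightarrow> int"
  assumes "I \<subseteq> {..<d}" "i < d"
  shows "(\<Sum>v\<in>unit_vec d ` I. a v * v $ i) = (if i \<in> I then a (unit_vec d i) else 0)"
proof -
  have fin: "finite I" using assms(1) finite_subset by blast
  have "(\<Sum>v\<in>unit_vec d ` I. a v * v $ i) = (\<Sum>j\<in>I. a (unit_vec d j) * unit_vec d j $ i)"
    by (rule sum.reindex[OF inj_on_unit_vec[OF assms(1)], unfolded o_def])
  also have "\<dots> = (\<Sum>j\<in>I. if j = i then a (unit_vec d j) else 0)"
    using assms by (intro sum.cong) auto
  finally show ?thesis using fin by simp
qed

lemma in_coordinate_span_iff: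
  assumes I: "I \<subseteq> {..<d}"
  shows "q \<in> int_span d (unit_vec d ` I) \<longleftrightarrow> q \<in> carrier_vec d \<and> (\<forall>i<d. i \<notin> I \<longrightarrow> q $ i = 0)"
proof -
  have fin: "finite (unit_vec d ` I :: int vec set)" using I finite_subset by blast
  have sub: "(unit_vec d ` I :: int vec set) \<subseteq> carrier_vec d" by auto
  have "(\<exists>a::int vec \<Rightarrow> int. \<forall>i<d. q $ i = (if i \<in> I then a (unit_vec d i) else 0))
      \<longleftrightarrow> (\<forall>i<d. i \<notin> I \<longrightarrow> q $ i = 0)" (is "?L \<longleftrightarrow> ?R")
  proof
    assume ?R
    \<comment> \<open>Coefficients are indexed by vectors rather than positions, so the position has
      to be recovered from the unit vector.\<close>
    define a :: "int vec \<Rightarrow> int" where "a v = q $ (THE i. i < d \<and> v = unit_vec d i)" for v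
    have "a (unit_vec d i) = q $ i" if "i < d" for i
    proof -
      have "(THE j. j < d \<and> (unit_vec d i :: int vec) = unit_vec d j) = i"
        using that inj_onD[OF inj_on_unit_vec[OF order_refl], of d] by (intro the_equality) auto
      then show ?thesis unfolding a_def by simp
    qed
    with \<open>?R\<close> show ?L by (intro exI[of _ a]) auto
  qed auto
  then show ?thesis
    unfolding in_int_span_iff[OF fin sub] using sum_unit_vecs[OF I] by simp
qed

lemma sublattice_coordinate_span:
  assumes I: "I \<subseteq> {..<d}"
  shows "sublattice d (card I) (int_span d (unit_vec d ` I))"
proof -
  have fin: "finite (unit_vec d ` I :: int vec set)" using I finite_subset by blast
  have sub: "(unit_vec d ` I :: int vec set) \<subseteq> carrier_vec d" by auto
  have "int_lin_indpt d (unit_vec d ` I)"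
  proof (rule int_lin_indptI[OF fin sub])
    fix a :: "int vec \<Rightarrow> int" and v :: "int vec"
    assume *: "\<forall>i<d. (\<Sum>v\<in>unit_vec d ` I. a v * v $ i) = 0" and "v \<in> unit_vec d ` I"
    then obtain i where i: "i \<in> I" "v = unit_vec d i" by blast
    then have "i < d" using I by auto
    then show "a v = 0" using * sum_unit_vecs[OF I, of i a] i by auto
  qed
  moreover have "card (unit_vec d ` I :: int vec set) = card I"
    by (rule card_image[OF inj_on_unit_vec[OF I]])
  ultimately show ?thesis unfolding sublattice_def using fin sub by blast
qed

text \<open>Missing generators are filled up with zero vectors, so that one determinant argument
  covers the ranks 0, 1 and 2.\<close>

lemma sublattice_small_generators:
  assumes "sublattice d R L" "R \<le> 2"
  obtains a b where "a \<in> carrier_vec d" "b \<in> carrier_vec d"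
    "\<And>q. q \<in> L \<Longrightarrow> q \<in> carrier_vec d \<and> (\<exists>\<alpha> \<beta>. \<forall>i<d. q $ i = \<alpha> * a $ i + \<beta> * b $ i)"
proof -
  obtain B where B: "B \<subseteq> carrier_vec d" "finite B" "card B = R" "L = int_span d B"
    using assms(1) unfolding sublattice_def by blast
  note L = in_int_span_iff[OF B(2,1), folded B(4)]
  consider "R = 0" | "R = 1" | "R = 2" using assms(2) by linarith
  then show ?thesis
  proof cases
    case 1
    then have B0: "B = {}" using B(2,3) by simp
    show ?thesis
    proof (rule that[of "0\<^sub>v d" "0\<^sub>v d"])
      fix q assume "q \<in> L"
      then show "q \<in> carrier_vec d \<and> (\<exists>\<alpha> \<beta>. \<forall>i<d. q $ i = \<alpha> * 0\<^sub>v d $ i + \<beta> * 0\<^sub>v d $ i)"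
        unfolding L B0 by auto
    qed auto
  next
    case 2
    then obtain v where Bv: "B = {v}" using B(3) card_1_singletonE by metis
    show ?thesis
    proof (rule that[of v "0\<^sub>v d"])
      fix q assume "q \<in> L"
      then show "q \<in> carrier_vec d \<and> (\<exists>\<alpha> \<beta>. \<forall>i<d. q $ i = \<alpha> * v $ i + \<beta> * 0\<^sub>v d $ i)"
        unfolding L Bv by auto
    qed (use B(1) Bv in auto)
  next
    case 3
    then obtain a b where Bab: "B = {a, b}" "a \<noteq> b" using B(3) card_2_iff by metis
    show ?thesis
    proof (rule that[of a b])
      fix q assume "q \<in> L"
      then show "q \<in> carrier_vec d \<and> (\<exists>\<alpha> \<beta>. \<forall>i<d. q $ i = \<alpha> * a $ i + \<beta> * b $ i)"
        unfolding L using Bab by auto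
    qed (use B(1) Bab in auto)
  qed
qed

section \<open>The rank of the tail\<close>

lemma height_uminus: "height (- q) = height q"
proof -
  have "hat (- q) $ i = - (hat q $ i)" if "i < dim_vec (hat q)" for i
    using that unfolding hat_def vec_first_def by auto
  then have "(\<lambda>i. \<bar>hat (- q) $ i\<bar>) ` {..<dim_vec (hat (- q))} = (\<lambda>i. \<bar>hat q $ i\<bar>) ` {..<dim_vec (hat q)}"
    by (intro image_cong) (auto simp: dim_hat)
  then show ?thesis unfolding max_norm_def by simp
qed

text \<open>Some best approximation no longer than \<open>c\<close> does at least as well as
  \<open>c\<close>. Being shorter than \<open>q (Suc k)\<close>, it is up to sign some
  \<open>q j\<close> with \<open>j \<le> k\<close>, and \<open>q k\<close> does at least as
  well.\<close>

lemma best_approximation_sequence_minimal: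
  assumes x: "x \<in> carrier_vec m" and seq: "best_approximation_sequence x q"
    and c: "c \<in> carrier_vec (Suc m)" "0 < height c" "height c < height (q (Suc k))"
  shows "\<bar>lin_form x (q k)\<bar> \<le> \<bar>lin_form x c\<bar>"
proof -
  have best: "best_approximation x (q j)" for j
    using seq unfolding best_approximation_sequence_def by blast
  have mono: "strict_mono (\<lambda>k. height (q k))"
    using seq unfolding best_approximation_sequence_def by blast
  obtain p where p: "best_approximation x p" "height p \<le> height c" "\<bar>lin_form x p\<bar> \<le> \<bar>lin_form x c\<bar>"
    using exists_best_approximation[OF x c(1,2) order_refl] c(1,2) by blast
  obtain j where "p = q j \<or> p = - q j"
    using seq p(1) unfolding best_approximation_sequence_def by blast
  then have hj: "height p = height (q j)" using height_uminus by auto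
  then have "height (q j) < height (q (Suc k))" using p(2) c(3) by linarith
  then have "j < Suc k" using strict_mono_less[OF mono] by blast
  then have "height p \<le> height (q k)"
    using hj strict_mono_less_eq[OF mono, of j k] by simp
  then have "\<bar>lin_form x (q k)\<bar> \<le> \<bar>lin_form x p\<bar>"
    using best[of k] p(1) unfolding best_approximation_iff[OF x] by blast
  with p(3) show ?thesis by linarith
qed

lemma best_approximation_sequence_height_ge:
  assumes "best_approximation_sequence x q"
  shows "int k \<le> height (q k)"
proof (induction k)
  case 0
  show ?case using height_nonneg by simp
next
  case (Suc k)
  have "height (q k) < height (q (Suc k))"
    using assms unfolding best_approximation_sequence_def strict_mono_def by simp
  with Suc show ?case by simp
qed

text \<open>In a lattice spanned by \<open>a\<close> and \<open>b\<close> the minors of consecutive best approximations are integer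
  multiples of the finitely many numbers \<open>a\<^sub>i L(b) - b\<^sub>i L(a)\<close>, while a uniform exponent
  greater than 1 makes these minors tend to 0.\<close>

lemma sublattice_rank_ge_3:
  assumes x: "x \<in> carrier_vec m" "totally_irrational x"
    and t: "1 < t" and C: "0 < C" and approx: "\<And>Q. Q0 \<le> Q \<Longrightarrow> \<exists>b \<in> carrier_vec (Suc m).
      0 < height b \<and> real_of_int (height b) \<le> Q \<and> \<bar>lin_form x b\<bar> \<le> C * Q powr (- t)"
    and L: "sublattice (Suc m) R L" "tail_in x L"
  shows "3 \<le> R"
proof (rule ccontr)
  assume "\<not> 3 \<le> R"
  then have "R \<le> 2" by simp
  then obtain a b where ab: "a \<in> carrier_vec (Suc m)" "b \<in> carrier_vec (Suc m)"
    "\<And>q. q \<in> L \<Longrightarrow> q \<in> carrier_vec (Suc m) \<and> (\<exists>\<alpha> \<beta>. \<forall>i<Suc m. q $ i = \<alpha> * a $ i + \<beta> * b $ i)"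
    using sublattice_small_generators[OF L(1)] by blast
  define D where "D i = real_of_int (a $ i) * lin_form x b - real_of_int (b $ i) * lin_form x a" for i
  \<comment> \<open>A positive lower bound for all nonzero \<open>\<bar>D i\<bar>\<close>; the
    inserted 1 covers the case in which every \<open>D i\<close> vanishes.\<close>
  define M where "M = Min (insert 1 ((\<lambda>i. \<bar>D i\<bar>) ` {i. i < m \<and> D i \<noteq> 0}))"
  have M: "0 < M" unfolding M_def by auto
  have MD: "M \<le> \<bar>D i\<bar>" if "i < m" "D i \<noteq> 0" for i
    unfolding M_def using that by (intro Min_le) auto
  have "((\<lambda>X::real. 4 * C * X powr (- (t - 1))) \<longlongrightarrow> 4 * C * 0) at_top"
    by (intro tendsto_mult tendsto_const tendsto_neg_powr filterlim_ident) (use t in simp)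
  then have "eventually (\<lambda>X::real. 4 * C * X powr (- (t - 1)) < M \<and> max Q0 1 \<le> X) at_top"
    using M by (intro eventually_conj eventually_ge_at_top) (auto intro: order_tendstoD)
  then obtain Y0 where Y0: "\<And>X. Y0 \<le> X \<Longrightarrow> 4 * C * X powr (- (t - 1)) < M \<and> max Q0 1 \<le> X"
    unfolding eventually_at_top_linorder by blast
  obtain q k0 where q: "best_approximation_sequence x q" "\<And>k. k0 \<le> k \<Longrightarrow> q k \<in> L"
    using L(2) unfolding tail_in_def by blast
  define k where "k = max k0 (nat \<lceil>Y0\<rceil>)"
  \<comment> \<open>One below the next height: admissible vectors of height at most \<open>Y\<close>
    are strictly shorter than \<open>q (Suc k)\<close>, so none improves on
    \<open>q k\<close>.\<close>
  define Y where "Y = real_of_int (height (q (Suc k))) - 1"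
  have "Y0 \<le> real k" unfolding k_def by linarith
  also have "real k \<le> Y"
    unfolding Y_def using best_approximation_sequence_height_ge[OF q(1), of "Suc k"] by simp
  finally have Y: "4 * C * Y powr (- (t - 1)) < M" "Q0 \<le> Y" "1 \<le> Y" using Y0[of Y] by auto
  have best: "best_approximation x (q j)" for j
    using q(1) unfolding best_approximation_sequence_def by blast
  have carrier: "q j \<in> carrier_vec (Suc m)" "0 < height (q j)" for j
    using best[of j] unfolding best_approximation_iff[OF x(1)] by auto
  have less: "height (q k) < height (q (Suc k))"
    using q(1) unfolding best_approximation_sequence_def strict_mono_def by simp
  have decreasing: "\<bar>lin_form x (q (Suc k))\<bar> \<le> \<bar>lin_form x (q k)\<bar>"
    using best[of "Suc k"] carrier[of k] less unfolding best_approximation_iff[OF x(1)] by auto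
  obtain c where c: "c \<in> carrier_vec (Suc m)" "0 < height c" "real_of_int (height c) \<le> Y"
    "\<bar>lin_form x c\<bar> \<le> C * Y powr (- t)"
    using approx[OF Y(2)] by blast
  have "height c < height (q (Suc k))" using c(3) unfolding Y_def by linarith
  then have "\<bar>lin_form x (q k)\<bar> \<le> \<bar>lin_form x c\<bar>"
    by (rule best_approximation_sequence_minimal[OF x(1) q(1) c(1,2)])
  then have small: "\<bar>lin_form x (q k)\<bar> \<le> C * Y powr (- t)" using c(4) by linarith
  obtain i where i: "i < m"
    "real_of_int (q k $ i) * lin_form x (q (Suc k)) \<noteq> real_of_int (q (Suc k) $ i) * lin_form x (q k)"
    using exists_nonzero_minor[OF carrier(1) carrier(1) less decreasing lin_form_nonzero[OF x(2,1) carrier]]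
    by blast
  define N where "N = real_of_int (q k $ i) * lin_form x (q (Suc k)) - real_of_int (q (Suc k) $ i) * lin_form x (q k)"
  have "N \<noteq> 0" using i(2) unfolding N_def by simp
  have "q k \<in> L" "q (Suc k) \<in> L" using q(2) unfolding k_def by simp_all
  then obtain \<alpha> \<beta> \<alpha>' \<beta>' where coords: "\<And>i. i < Suc m \<Longrightarrow> q k $ i = \<alpha> * a $ i + \<beta> * b $ i"
    "\<And>i. i < Suc m \<Longrightarrow> q (Suc k) $ i = \<alpha>' * a $ i + \<beta>' * b $ i"
    using ab(3) by meson
  have lin: "lin_form x r = real_of_int \<mu> * lin_form x a + real_of_int \<nu> * lin_form x b"
    if "r \<in> carrier_vec (Suc m)" "\<And>i. i < Suc m \<Longrightarrow> r $ i = \<mu> * a $ i + \<nu> * b $ i" for r \<mu> \<nu>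
    unfolding lin_form_eq[OF x(1) that(1)] lin_form_eq[OF x(1) ab(1)] lin_form_eq[OF x(1) ab(2)]
    using that(2) by (simp add: sum_distrib_left sum.distrib algebra_simps)
  \<comment> \<open>The minor of two combinations of \<open>a\<close> and \<open>b\<close> is the
    determinant of the coefficients times that of \<open>a\<close> and \<open>b\<close>. As
    \<open>N\<close> is nonzero, the integer determinant has absolute value at least 1.\<close>
  have N: "N = real_of_int (\<alpha> * \<beta>' - \<beta> * \<alpha>') * D i"
  proof -
    have "lin_form x (q k) = real_of_int \<alpha> * lin_form x a + real_of_int \<beta> * lin_form x b"
      by (rule lin[OF carrier(1)]) (rule coords(1))
    moreover have "lin_form x (q (Suc k)) = real_of_int \<alpha>' * lin_form x a + real_of_int \<beta>' * lin_form x b"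
      by (rule lin[OF carrier(1)]) (rule coords(2))
    ultimately show ?thesis
      unfolding N_def D_def using coords[of i] i(1) by (simp add: algebra_simps)
  qed
  with \<open>N \<noteq> 0\<close> have nz: "\<alpha> * \<beta>' - \<beta> * \<alpha>' \<noteq> 0" "D i \<noteq> 0" by force+
  have "M \<le> \<bar>D i\<bar>" by (rule MD[OF i(1) nz(2)])
  also have "\<dots> \<le> \<bar>N\<bar>"
  proof -
    have "1 \<le> \<bar>real_of_int (\<alpha> * \<beta>' - \<beta> * \<alpha>')\<bar>" using nz(1) by linarith
    then show ?thesis unfolding N abs_mult using mult_right_mono[of 1 _ "\<bar>D i\<bar>"] by simp
  qed
  also have "\<bar>N\<bar> \<le> 2 * Y * (C * Y powr (- t)) + 2 * Y * (C * Y powr (- t))"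
  proof -
    \<comment> \<open>Both heights are at most \<open>Y + 1\<close>, and \<open>Y\<close> is at
      least 1.\<close>
    have "\<bar>real_of_int (q j $ i)\<bar> \<le> 2 * Y" if "j = k \<or> j = Suc k" for j
    proof -
      have "height (q j) \<le> height (q (Suc k))" using that less by auto
      then have "\<bar>q j $ i\<bar> \<le> height (q (Suc k))"
        using abs_index_le_height[OF carrier(1) i(1), of j] by linarith
      then have "real_of_int \<bar>q j $ i\<bar> \<le> Y + 1" unfolding Y_def by simp
      then show ?thesis using Y(3) by simp
    qed
    then have "\<bar>real_of_int (q k $ i) * lin_form x (q (Suc k))\<bar> \<le> 2 * Y * (C * Y powr (- t))"
      "\<bar>real_of_int (q (Suc k) $ i) * lin_form x (q k)\<bar> \<le> 2 * Y * (C * Y powr (- t))"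
      unfolding abs_mult using small decreasing Y(3) by (auto intro!: mult_mono)
    then show ?thesis unfolding N_def by linarith
  qed
  also have "\<dots> = 4 * C * Y powr (- (t - 1))"
    using powr_add[of Y 1 "- t"] Y(3) by simp
  finally show False using Y(1) by simp
qed

section \<open>Equality of the exponents\<close>

lemma planar_embedding_surj:
  assumes "q \<in> carrier_vec (Suc (m + 2))" "\<And>i. i < m \<Longrightarrow> q $ (i + 2) = 0"
  obtains p where "p \<in> carrier_vec 3" "planar_embedding m p = q"
proof
  let ?p = "vec 3 (\<lambda>i. if i < 2 then q $ i else q $ (m + 2))"
  show "?p \<in> carrier_vec 3" by simp
  show "planar_embedding m ?p = q"
  proof (rule eq_vecI)
    fix i assume i: "i < dim_vec q"
    then consider "i < 2" | "i = m + 2" | "2 \<le> i" "i < m + 2"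
      using assms(1) by fastforce
    then show "planar_embedding m ?p $ i = q $ i"
    proof cases
      case 3
      then have "i - 2 < m" "i = i - 2 + 2" by auto
      then have "q $ i = 0" using assms(2)[of "i - 2"] by metis
      then show ?thesis using 3 unfolding planar_embedding_def by simp
    qed (auto simp: planar_embedding_def)
  qed (use assms(1) in \<open>auto simp: planar_embedding_def\<close>)
qed

text \<open>One inequality embeds the vectors for \<open>y\<close>. For the other, the minimiser up
  to a large \<open>Q\<close> has a small value, hence a large height, hence by
  \<open>planar\<close> comes from a vector for \<open>y\<close>.\<close>

lemma min_form_eventually_eq:
  assumes y: "y \<in> carrier_vec 2" and z: "z \<in> carrier_vec m"
    and irr: "totally_irrational (y @\<^sub>v z)"
    and small: "\<And>\<epsilon>. 0 < \<epsilon> \<Longrightarrow>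
      \<exists>b \<in> carrier_vec (Suc (m + 2)). 0 < height b \<and> \<bar>lin_form (y @\<^sub>v z) b\<bar> < \<epsilon>"
    and planar: "\<And>q i. best_approximation (y @\<^sub>v z) q \<Longrightarrow> K \<le> height q \<Longrightarrow> i < m \<Longrightarrow> q $ (i + 2) = 0"
  shows "eventually (\<lambda>Q. min_form (y @\<^sub>v z) Q = min_form y Q) at_top"
proof -
  let ?x = "y @\<^sub>v z"
  have yz: "?x \<in> carrier_vec (m + 2)"
    using append_carrier_vec[OF y z] by (simp add: add.commute)
  have dim: "dim_vec ?x + 1 = Suc (m + 2)" "dim_vec y + 1 = 3"
    using carrier_vecD[OF yz] carrier_vecD[OF y] by simp_all
  obtain \<delta> where \<delta>: "0 < \<delta>" "\<And>b. b \<in> carrier_vec (Suc (m + 2)) \<Longrightarrow> 0 < height b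
      \<Longrightarrow> \<bar>lin_form ?x b\<bar> < \<delta> \<Longrightarrow> K < height b"
    using height_large_if_lin_form_small[OF yz irr, where K = K] by blast
  obtain b where b: "b \<in> carrier_vec (Suc (m + 2))" "0 < height b" "\<bar>lin_form ?x b\<bar> < \<delta>"
    using small[OF \<delta>(1)] by blast
  have "min_form ?x Q = min_form y Q" if Q: "real_of_int (height b) \<le> Q" for Q
  proof (rule antisym)
    show "min_form ?x Q \<le> min_form y Q"
      unfolding min_form_def dim
    proof (rule INF_mono)
      fix p :: "int vec" assume "p \<in> {b \<in> carrier_vec 3. 0 < height b \<and> real_of_int (height b) \<le> Q}"
      then show "\<exists>q \<in> {b \<in> carrier_vec (Suc (m + 2)). 0 < height b \<and> real_of_int (height b) \<le> Q}.
          ennreal \<bar>lin_form ?x q\<bar> \<le> ennreal \<bar>lin_form y p\<bar>"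
        using planar_embedding_carrier height_planar_embedding lin_form_planar_embedding[OF y z]
        by (intro bexI[of _ "planar_embedding m p"]) auto
    qed
    \<comment> \<open>Heights are integers, so \<open>Q\<close> may be replaced by its floor. The
      vector \<open>b\<close> is admissible there, which brings the minimum below
      \<open>\<delta>\<close>.\<close>
    have "height b \<le> \<lfloor>Q\<rfloor>" using Q by linarith
    then obtain p where p: "best_approximation ?x p" "height p \<le> \<lfloor>Q\<rfloor>"
      "\<And>c. c \<in> carrier_vec (Suc (m + 2)) \<Longrightarrow> 0 < height c \<Longrightarrow> height c \<le> \<lfloor>Q\<rfloor> \<Longrightarrow>
        \<bar>lin_form ?x p\<bar> \<le> \<bar>lin_form ?x c\<bar>"
      using exists_best_approximation[OF yz b(1,2)] by blast
    have pc: "p \<in> carrier_vec (Suc (m + 2))" "0 < height p"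
      using p(1) unfolding best_approximation_iff[OF yz] by auto
    have "\<bar>lin_form ?x p\<bar> < \<delta>" using p(3)[OF b(1,2) \<open>height b \<le> \<lfloor>Q\<rfloor>\<close>] b(3) by linarith
    then have "K \<le> height p" using \<delta>(2)[OF pc] by simp
    then obtain r where r: "r \<in> carrier_vec 3" "planar_embedding m r = p"
      using planar_embedding_surj[OF pc(1)] planar[OF p(1)] by blast
    have hr: "height r = height p" "lin_form y r = lin_form ?x p"
      using height_planar_embedding[OF r(1), of m] lin_form_planar_embedding[OF y z r(1)] r(2) by simp_all
    have "min_form y Q \<le> ennreal \<bar>lin_form y r\<bar>"
      unfolding min_form_def dim
    proof (rule INF_lower)
      have "real_of_int (height p) \<le> Q" using p(2) by linarith
      then show "r \<in> {b \<in> carrier_vec 3. 0 < height b \<and> real_of_int (height b) \<le> Q}"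
        using r(1) hr(1) pc(2) by simp
    qed
    also have "\<dots> \<le> min_form ?x Q"
      unfolding min_form_def dim hr(2)
    proof (rule INF_greatest)
      fix c assume "c \<in> {b \<in> carrier_vec (Suc (m + 2)). 0 < height b \<and> real_of_int (height b) \<le> Q}"
      then have "c \<in> carrier_vec (Suc (m + 2))" "0 < height c" "height c \<le> \<lfloor>Q\<rfloor>"
        by (simp_all add: le_floor_iff)
      then show "ennreal \<bar>lin_form ?x p\<bar> \<le> ennreal \<bar>lin_form ?x c\<bar>"
        using p(3) by (intro ennreal_leI)
    qed
    finally show "min_form y Q \<le> min_form ?x Q" .
  qed
  then show ?thesis unfolding eventually_at_top_linorder by blast
qed

lemma exponents_cong:
  assumes "eventually (\<lambda>Q. min_form x Q = min_form y Q) at_top"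
  shows "omega_hat x = omega_hat y" "omega x = omega y"
proof -
  have ev: "eventually (\<lambda>Q::real. ennreal (Q powr t) * min_form x Q = ennreal (Q powr t) * min_form y Q) at_top" for t
    using assms by eventually_elim simp
  show "omega_hat x = omega_hat y" unfolding omega_hat_def using Limsup_eq[OF ev] by simp
  show "omega x = omega y" unfolding omega_def using Liminf_eq[OF ev] by simp
qed

text \<open>Working with \<open>m = n - 2\<close> avoids subtraction: \<open>3 * m + 2\<close> is
  \<open>3n - 4\<close>.\<close>

lemma T_set_properties:
  fixes m :: nat
  defines "n \<equiv> m + 2"
  defines "L \<equiv> int_span (n + 1) (unit_vec (n + 1) ` {0, 1, n})"
  assumes y: "y \<in> carrier_vec 2" and z: "z \<in> carrier_vec m"
    and irr: "totally_irrational (y @\<^sub>v z)"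
    and hat: "ennreal (3 * real m + 2) < omega_hat y" and om: "omega z = ennreal (real m)"
  shows "tail_in (y @\<^sub>v z) L" "approximation_rank (y @\<^sub>v z) = 3"
    "omega_hat (y @\<^sub>v z) = omega_hat y" "omega (y @\<^sub>v z) = omega y"
proof -
  let ?x = "y @\<^sub>v z"
  have yz: "?x \<in> carrier_vec n"
    unfolding n_def using append_carrier_vec[OF y z] by (simp add: add.commute)
  have sub: "{0, 1, n} \<subseteq> {..<n + 1}" unfolding n_def by auto
  have card: "card {0, 1, n} = 3" unfolding n_def by simp
  have nonneg: "0 \<le> 3 * real m + 2" by simp
  obtain t C Q0 where t: "3 * real m + 2 < t" and C: "0 < C" and approx_y:
    "\<And>Q. Q0 \<le> Q \<Longrightarrow> \<exists>b \<in> carrier_vec (Suc 2).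
      0 < height b \<and> real_of_int (height b) \<le> Q \<and> \<bar>lin_form y b\<bar> \<le> C * Q powr (- t)"
    by (rule omega_hat_gtD[OF y nonneg hat]) blast
  \<comment> \<open>The embedding carries the uniform approximations of \<open>y\<close> over with
    the same constants. They yield the existence of the sequence and the lower bound for the
    rank.\<close>
  have approx: "\<exists>b \<in> carrier_vec (Suc n).
      0 < height b \<and> real_of_int (height b) \<le> Q \<and> \<bar>lin_form ?x b\<bar> \<le> C * Q powr (- t)"
    if Q: "Q0 \<le> Q" for Q
  proof -
    obtain b where b: "b \<in> carrier_vec 3"
      "0 < height b" "real_of_int (height b) \<le> Q" "\<bar>lin_form y b\<bar> \<le> C * Q powr (- t)"
      using approx_y[OF Q] by (auto simp: numeral_3_eq_3 numeral_2_eq_2)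
    show ?thesis
      using b planar_embedding_carrier[of m b] height_planar_embedding[OF b(1), of m]
        lin_form_planar_embedding[OF y z b(1)]
      unfolding n_def by (intro bexI[of _ "planar_embedding m b"]) simp_all
  qed
  have "0 < t" using t nonneg by linarith
  have small: "\<exists>b \<in> carrier_vec (Suc n). 0 < height b \<and> \<bar>lin_form ?x b\<bar> < \<epsilon>" if "0 < \<epsilon>" for \<epsilon>
    by (rule approximable_imp_small[OF \<open>0 < t\<close> approx that])
  obtain K where K: "\<And>q i. best_approximation ?x q \<Longrightarrow> K \<le> height q \<Longrightarrow> i < m \<Longrightarrow> q $ (i + 2) = 0"
    using best_approximation_eventually_planar[OF y z irr hat om] by blast
  obtain q where q: "best_approximation_sequence ?x q"
    using exists_best_approximation_sequence[OF yz irr small] by blast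
  \<comment> \<open>Heights grow at least as fast as the index, so from \<open>nat K\<close> on
    every member is long enough to be planar.\<close>
  have "q k \<in> L" if "nat K \<le> k" for k
  proof -
    have best: "best_approximation ?x (q k)"
      using q unfolding best_approximation_sequence_def by blast
    have "K \<le> height (q k)"
      using best_approximation_sequence_height_ge[OF q, of k] that by linarith
    then have zero: "q k $ (i + 2) = 0" if "i < m" for i using K[OF best _ that] by blast
    have "q k $ i = 0" if "i < n + 1" "i \<notin> {0, 1, n}" for i
    proof -
      have "i - 2 < m" "i = i - 2 + 2" using that unfolding n_def by auto
      then show ?thesis using zero[of "i - 2"] by metis
    qed
    moreover have "q k \<in> carrier_vec (n + 1)"
      using best unfolding best_approximation_iff[OF yz] by simp
    ultimately show ?thesis unfolding L_def in_coordinate_span_iff[OF sub] by blast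
  qed
  then show tail: "tail_in ?x L" unfolding tail_in_def using q by blast
  have dim: "dim_vec ?x + 1 = Suc n" using carrier_vecD[OF yz] by simp
  show "approximation_rank ?x = 3"
    unfolding approximation_rank_def dim
  proof (rule Least_equality)
    show "\<exists>L. sublattice (Suc n) 3 L \<and> tail_in ?x L"
      using sublattice_coordinate_span[OF sub] tail card unfolding L_def by auto
    fix R assume "\<exists>L. sublattice (Suc n) R L \<and> tail_in ?x L"
    moreover have "1 < t" using t nonneg by linarith
    ultimately show "3 \<le> R"
      using sublattice_rank_ge_3[OF yz irr _ C approx] by blast
  qed
  have "eventually (\<lambda>Q. min_form ?x Q = min_form y Q) at_top"
    using min_form_eventually_eq[OF y z irr small[unfolded n_def] K] by blast
  then show "omega_hat ?x = omega_hat y" "omega ?x = omega y" by (rule exponents_cong)+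
qed

theorem theorem7:
  fixes n :: nat
  assumes "n \<ge> 2"
  shows "sublattice (n + 1) 3 (int_span (n + 1) {unit_vec (n + 1) 0, unit_vec (n + 1) 1, unit_vec (n + 1) n}) \<and>
    (\<forall>x \<in> T_set n. tail_in x (int_span (n + 1) {unit_vec (n + 1) 0, unit_vec (n + 1) 1, unit_vec (n + 1) n})) \<and>
    T_set n \<subseteq> Gamma_set n \<and>
    (\<forall>x \<in> T_set n. omega_hat x = omega_hat (vec_first x 2) \<and> omega x = omega (vec_first x 2))"
proof -
  obtain m where n: "n = m + 2" using assms by (metis add.commute le_Suc_ex)
  let ?L = "int_span (n + 1) {unit_vec (n + 1) 0, unit_vec (n + 1) 1, unit_vec (n + 1) n}"
  have L: "?L = int_span (n + 1) (unit_vec (n + 1) ` {0, 1, n})" by simp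
  have "sublattice (n + 1) (card {0, 1, n}) (int_span (n + 1) (unit_vec (n + 1) ` {0, 1, n}))"
    by (rule sublattice_coordinate_span) (use assms in auto)
  moreover have "card {0, 1, n} = 3" unfolding n by simp
  ultimately have "sublattice (n + 1) 3 ?L" unfolding L by simp
  moreover have "tail_in x ?L \<and> x \<in> Gamma_set n
      \<and> omega_hat x = omega_hat (vec_first x 2) \<and> omega x = omega (vec_first x 2)"
    if T: "x \<in> T_set n" for x
  proof -
    \<comment> \<open>The case \<open>m = 0\<close> is included: \<open>z\<close> then has dimension
      0, and both sides of \<open>omega z = ennreal (real m)\<close> are 0.\<close>
    have arith: "3 * real (m + 2) - 4 = 3 * real m + 2" "real (m + 2) - 2 = real m" "m + 2 - 2 = m"
      by simp_all
    obtain y z where x: "x = y @\<^sub>v z" and y: "y \<in> carrier_vec 2" and z: "z \<in> carrier_vec m"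
      and hat: "ennreal (3 * real m + 2) < omega_hat y" and om: "omega z = ennreal (real m)"
      and irr: "totally_irrational (y @\<^sub>v z)"
      using T unfolding T_set_def n arith by blast
    have "x \<in> carrier_vec n"
      unfolding x n using append_carrier_vec[OF y z] by (simp add: add.commute)
    moreover have "vec_first x 2 = y"
      unfolding x vec_first_def using y by (intro eq_vecI) auto
    ultimately show ?thesis
      using T_set_properties[OF y z irr hat om] irr unfolding L Gamma_set_def x n by simp
  qed
  ultimately show ?thesis by blast
qed

end
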